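(* As formal power series, \[ A_{\{2,3\}}(x,y) =\frac{1 - x - x^{3} y}{(1-x^2y^2-x^3y^3)(1-x-x^3y)-2x^5y}, \] and for any integer $c \geq 1$, $A_{\{2c,3c\}}(x,y) = A_{\{2,3\}}(x^c,y^c)$.
   Context: A composition of $n$ is an ordered list of positive integers (parts) with sum $n$; the empty list is the unique composition of $0$. A meander on $n$ nodes is a pair $\frac{\lambda}{\mu}$ of compositions of $n$, viewed as a planar (multi)graph on vertices $1,\dots,n$: for each part $a$ of $\lambda$, occupying the consecutive vertices $p+1,\dots,p+a$ (where $p$ is the sum of the preceding parts), there is an upper edge joining $p+i$ and $p+a+1-i$ for each $1\le i\le \lfloor a/2\rfloor$; lower edges are defined in the same way from $\mu$. If the same two vertices are joined by both an upper and a lower edge, both edges are kept and form a cycle. Every connected component is a cycle or a path (an isolated vertex counts as a path). The index is $\operatorname{ind}(\frac{\lambda}{\mu}) = 2c+p$, where here $c$ is the number of cycles and $p$ is the number of paths (this equals the index of the associated seaweed subalgebra of $\mathfrak{gl}_n$). For a set $J$ of positive integers, $a^J_{n,k}$ is the number of meanders $\frac{\lambda}{\mu}$ on $n$ nodes of index $k$ such that all parts of $\lambda$ and $\mu$ lie in $J$, and $A_J(x,y)=\sum_{n,k\ge 0} a^J_{n,k}x^ny^k$ (the empty meander gives $a^J_{0,0}=1$). *)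

theory Defs
  imports "HOL-Computational_Algebra.Formal_Power_Series"
begin

definition composition_of :: "nat \<Rightarrow> nat list \<Rightarrow> bool" where
  "composition_of n la \<longleftrightarrow> (\<forall>a \<in> set la. 0 < a) \<and> sum_list la = n"

text \<open>
  A multigraph is given by a vertex set and a set of labelled edges \<open>(s, {u, v})\<close>; the label keeps
  parallel edges apart.
\<close>

datatype side = Upper | Lower

type_synonym edge = "side \<times> nat set"

text \<open>The first argument is the sum \<open>p\<close> of the preceding parts.\<close>

fun block_arcs :: "nat \<Rightarrow> nat list \<Rightarrow> nat set set" where
  "block_arcs p [] = {}"
| "block_arcs p (a # la) =
     {{p + i, p + a + 1 - i} | i. 1 \<le> i \<and> i \<le> a div 2} \<union> block_arcs (p + a) la"

definition meander_edges :: "nat list \<Rightarrow> nat list \<Rightarrow> edge set" where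
  "meander_edges la mu = {Upper} \<times> block_arcs 0 la \<union> {Lower} \<times> block_arcs 0 mu"

definition adjacency :: "edge set \<Rightarrow> (nat \<times> nat) set" where
  "adjacency E = {(u, v). \<exists>s. (s, {u, v}) \<in> E}"

definition components :: "nat set \<Rightarrow> edge set \<Rightarrow> nat set set" where
  "components V E = V // {(u, v). u \<in> V \<and> v \<in> V \<and> (u, v) \<in> (adjacency E)\<^sup>*}"

definition edges_within :: "edge set \<Rightarrow> nat set \<Rightarrow> edge set" where
  "edges_within E C = {e \<in> E. snd e \<subseteq> C}"

text \<open>
  The subgraph on the vertices \<open>C\<close> is a path (resp. cycle) if its vertices and its edges can each be
  listed without repetition so that the \<open>i\<close>-th edge joins the \<open>i\<close>-th vertex to the (cyclically) next
  one. A path may consist of a single vertex; a cycle may consist of two parallel edges.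
\<close>

definition is_path :: "edge set \<Rightarrow> nat set \<Rightarrow> bool" where
  "is_path E C \<longleftrightarrow> (\<exists>vs es.
     distinct vs \<and> set vs = C \<and> distinct es \<and> set es = edges_within E C \<and>
     length vs = length es + 1 \<and>
     (\<forall>i < length es. snd (es ! i) = {vs ! i, vs ! (i + 1)}))"

definition is_cycle :: "edge set \<Rightarrow> nat set \<Rightarrow> bool" where
  "is_cycle E C \<longleftrightarrow> (\<exists>vs es.
     distinct vs \<and> set vs = C \<and> distinct es \<and> set es = edges_within E C \<and>
     length vs = length es \<and> 2 \<le> length es \<and>
     (\<forall>i < length es. snd (es ! i) = {vs ! i, vs ! ((i + 1) mod length vs)}))"

definition meander_index :: "nat \<Rightarrow> nat list \<Rightarrow> nat list \<Rightarrow> nat" where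
  "meander_index n la mu =
     2 * card {C \<in> components {1..n} (meander_edges la mu). is_cycle (meander_edges la mu) C} +
     card {C \<in> components {1..n} (meander_edges la mu). is_path (meander_edges la mu) C}"

definition meander_count :: "nat set \<Rightarrow> nat \<Rightarrow> nat \<Rightarrow> nat" where
  "meander_count J n k =
     card {(la, mu). composition_of n la \<and> composition_of n mu \<and>
       set la \<subseteq> J \<and> set mu \<subseteq> J \<and> meander_index n la mu = k}"

text \<open>
  Power series in \<open>x\<close> and \<open>y\<close> are power series in \<open>x\<close> (outer variable) whose coefficients are power
  series in \<open>y\<close> (inner variable). The base ring is \<open>rat\<close> because \<open>(/)\<close> on power series needs an
  \<open>inverse\<close> on coefficients; \<open>f / g\<close> is the genuine quotient \<open>f g\<^sup>-\<^sup>1\<close> when the constant term of \<open>g\<close>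
  is \<open>1\<close>.
\<close>

type_synonym fps2 = "rat fps fps"

abbreviation X :: fps2 where "X \<equiv> fps_X"

abbreviation Y :: fps2 where "Y \<equiv> fps_const fps_X"

definition meander_gf :: "nat set \<Rightarrow> fps2" where
  "meander_gf J = Abs_fps (\<lambda>n. Abs_fps (\<lambda>k. of_nat (meander_count J n k)))"

text \<open>\<open>F(x\<^sup>c, y\<^sup>c)\<close>, for \<open>c \<ge> 1\<close>.\<close>

definition subst_powers :: "nat \<Rightarrow> fps2 \<Rightarrow> fps2" where
  "subst_powers c F = Abs_fps (\<lambda>n. fps_nth F n oo fps_X ^ c) oo fps_X ^ c"

end

theory Submission
  imports Defs "HOL-Combinatorics.Orbits"
begin

text \<open>
  Reversing every block of \<open>\<lambda>\<close> (resp. \<open>\<mu>\<close>) is an involution \<open>s\<close> (resp. \<open>t\<close>) of the vertices. A cycle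
  of the meander splits into two orbits of \<open>s \<circ> t\<close>, while a path is a single orbit, because \<open>s\<close> or
  \<open>t\<close> fixes its end points; hence the index is the number of orbits of \<open>s \<circ> t\<close>.

  Scaling all parts by \<open>c\<close> replaces this permutation by \<open>c\<close> disjoint copies of itself, which gives
  the second claim. For the first one, split a leading block \<open>2\<close> or \<open>3\<close> into blocks \<open>1\<close>; this
  composes an involution with a transposition and changes the number of orbits by one if one of the
  two points was fixed. Equal leading blocks \<open>1\<close> can be removed. So reading the blocks from the
  left leads only to balanced pairs, counted by \<open>A\<close>, and to pairs in which one side has a leading
  block \<open>1\<close>, counted by \<open>B\<close>:
  \<open>A = 1 + (x\<^sup>2 y\<^sup>2 + x\<^sup>3 y\<^sup>3) A + 2 x\<^sup>2 B\<close> and \<open>B = x B + x\<^sup>3 y A + x\<^sup>3 y B\<close>.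
\<close>

unbundle fps_syntax

section \<open>Orbits of permutations\<close>

definition orbit_count :: "('a \<Rightarrow> 'a) \<Rightarrow> 'a set \<Rightarrow> nat" where
  "orbit_count f S = card (orbit f ` S)"

text \<open>An orbit consists of the iterates \<open>(f ^^ n) x\<close> with positive
  \<open>n\<close>, so returning to \<open>x\<close> uses that \<open>f\<close> permutes a finite
  set.\<close>

lemma self_in_orbit:
  assumes "f permutes S" "finite S"
  shows "x \<in> orbit f x"
  using assms by (intro permutation_self_in_orbit) (auto simp: permutation_permutes)

lemma orbit_eq_if_mem:
  assumes "f permutes S" "finite S" "y \<in> orbit f x"
  shows "orbit f y = orbit f x"
  using orbit_cyclic_eq3[OF cyclic_on_orbit[OF assms(1,2)] assms(3)] .

lemma orbit_count_fixed_point: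
  assumes f: "f permutes S" and fin: "finite S" and x: "x \<in> S" "f x = x"
  shows "orbit_count f S = Suc (orbit_count f (S - {x}))"
proof -
  have x': "orbit f x = {x}"
    using x orbit_eq_singleton_iff by metis
  have "{x} \<notin> orbit f ` (S - {x})"
    using self_in_orbit[OF f fin] by auto
  moreover have "orbit f ` S = insert {x} (orbit f ` (S - {x}))"
    using x' x by auto
  ultimately show ?thesis
    using fin by (simp add: orbit_count_def)
qed

text \<open>The new permutation sends \<open>y\<close> to \<open>x\<close> and \<open>x\<close> to
  \<open>g y\<close>: the fixed point \<open>x\<close> is inserted into the orbit of
  \<open>y\<close>, and every other orbit stays as it is.\<close>

lemma orbit_count_transpose:
  assumes g: "g permutes S" and fin: "finite S" and x: "x \<in> S" "g x = x" and y: "y \<in> S" "x \<noteq> y"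
  shows "orbit_count g S = Suc (orbit_count (g \<circ> transpose x y) S)"
proof -
  define f where "f = g \<circ> transpose x y"
  have fx: "f x = g y" and fy: "f y = x" and fz: "\<And>z. z \<noteq> x \<Longrightarrow> z \<noteq> y \<Longrightarrow> f z = g z"
    using x by (simp_all add: f_def)
  have f: "f permutes S"
    unfolding f_def using g x y by (intro permutes_compose permutes_swap_id)
  define C where "C = orbit g y"
  have xC: "x \<notin> C"
  proof
    assume "x \<in> C"
    then have "orbit g x = C"
      unfolding C_def using orbit_eq_if_mem[OF g fin] by blast
    moreover have "orbit g x = {x}"
      using x orbit_eq_singleton_iff by metis
    ultimately show False
      using self_in_orbit[OF g fin, of y] y C_def by auto
  qed
  have yC: "y \<in> C" using self_in_orbit[OF g fin] C_def by auto
  have xy: "x \<in> orbit f y"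
    using fy orbit.base by metis
  have "orbit f y \<subseteq> insert x C"
  proof
    fix z assume "z \<in> orbit f y"
    then show "z \<in> insert x C"
    proof induction
      case base
      then show ?case by (simp add: fy)
    next
      case (step z)
      then show ?case
        using fx fy fz[of z] unfolding C_def by (cases "z = x"; cases "z = y") (auto intro: orbit.intros)
    qed
  qed
  moreover have "C \<subseteq> orbit f y"
  proof
    fix z assume "z \<in> C"
    then show "z \<in> orbit f y"
      unfolding C_def
    proof induction
      case base
      then show ?case using fx fy by (metis orbit.intros)
    next
      case (step z)
      have "f x \<in> orbit f y"
        using fy by (metis orbit.intros)
      then show ?case
        using fx fz[of z] orbit.step[OF step.IH] xy x
        by (cases "z = x"; cases "z = y") auto
    qed
  qed
  ultimately have fC: "orbit f y = insert x C" using xy by blast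
  \<comment> \<open>The orbits of points of \<open>R\<close> avoid both \<open>x\<close> and
    \<open>y\<close>, so \<open>f\<close> and \<open>g\<close> agree on them.\<close>
  define R where "R = S - insert x C"
  have R: "orbit f z = orbit g z" if "z \<in> R" for z
  proof (rule orbit_cong[OF self_in_orbit[OF g fin]])
    fix u assume u: "u \<in> orbit g z"
    have "u \<noteq> x"
      using u that orbit_eq_if_mem[OF g fin u] x(2) self_in_orbit[OF g fin, of z]
        orbit_eq_singleton_iff[of g x] by (auto simp: R_def)
    moreover have "u \<noteq> y"
      using u that orbit_eq_if_mem[OF g fin u] self_in_orbit[OF g fin, of z]
      by (auto simp: R_def C_def)
    ultimately show "f u = g u" by (rule fz)
  qed
  have CS: "C \<subseteq> S" unfolding C_def using g y by (simp add: permutes_orbit_subset)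
  have "orbit g ` S = insert {x} (insert C (orbit g ` R))"
  proof -
    have "orbit g z = C" if "z \<in> C" for z
      using that orbit_eq_if_mem[OF g fin] unfolding C_def by blast
    then have "orbit g ` C = {C}" using yC by blast
    moreover have "orbit g x = {x}" using x orbit_eq_singleton_iff by metis
    ultimately have "orbit g ` insert x C = {{x}, C}" by simp
    moreover have "S = insert x C \<union> R" using CS x by (auto simp: R_def)
    ultimately show ?thesis by (metis Un_insert_left image_Un sup_bot_left)
  qed
  moreover have "orbit f ` S = insert (insert x C) (orbit g ` R)"
  proof -
    have "orbit f z = insert x C" if "z \<in> insert x C" for z
      using that orbit_eq_if_mem[OF f fin, of z y] unfolding fC by blast
    then have "orbit f ` insert x C = {insert x C}" by blast
    moreover have "S = insert x C \<union> R" using CS x by (auto simp: R_def)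
    moreover have "orbit f ` R = orbit g ` R" using R by auto
    ultimately show ?thesis by (metis Un_insert_left image_Un sup_bot_left)
  qed
  \<comment> \<open>Every orbit of a point of \<open>R\<close> contains that point, which lies
    outside \<open>insert x C\<close>.\<close>
  moreover have "{x} \<notin> orbit g ` R" "C \<notin> orbit g ` R" "insert x C \<notin> orbit g ` R"
    using self_in_orbit[OF g fin] by (fastforce simp: R_def)+
  moreover have "{x} \<noteq> C" using xC by auto
  moreover have "finite (orbit g ` R)" using fin by (simp add: R_def)
  ultimately show ?thesis
    by (simp add: orbit_count_def flip: f_def)
qed

text \<open>The two compositions are inverse to each other, and inverse permutations have the same
  orbits.\<close>

lemma orbit_comp_commute:
  assumes "s permutes S" "t permutes S" "finite S" "\<And>x. s (s x) = x" "\<And>x. t (t x) = x"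
  shows "orbit (s \<circ> t) = orbit (t \<circ> s)"
proof -
  have "inv (s \<circ> t) = t \<circ> s"
    using assms(4,5) by (intro inv_unique_comp) (auto simp: fun_eq_iff)
  moreover have "permutation (s \<circ> t)"
    using permutes_compose[OF assms(2,1)] assms(3) by (auto simp: permutation_permutes)
  ultimately show ?thesis
    using orbit_inv_eq[of "s \<circ> t"] by auto
qed

text \<open>Transports orbits along a map that intertwines \<open>f\<close> and \<open>g\<close> on
  \<open>S\<close>; it serves for translating and for scaling.\<close>

lemma orbit_image:
  assumes "f permutes S" "finite S" "x \<in> S" "\<And>x. x \<in> S \<Longrightarrow> g (h x) = h (f x)"
  shows "orbit g (h x) = h ` orbit f x"
  using orbit_inverse[OF self_in_orbit[OF assms(1,2)], of x g h] assms(4)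
    permutes_orbit_subset[OF assms(1,3)] by blast

section \<open>Block reversals\<close>

text \<open>The involution whose two-element orbits are the arcs; centres of odd blocks and points
  outside all blocks are fixed. \<open>2 * p + a + 1\<close> is the sum of the first and the last
  point of the block.\<close>

fun flip :: "nat \<Rightarrow> nat list \<Rightarrow> nat \<Rightarrow> nat" where
  "flip p [] x = x"
| "flip p (a # la) x = (if p < x \<and> x \<le> p + a then 2 * p + a + 1 - x else flip (p + a) la x)"

lemma flip_outside: "x \<le> p \<or> p + sum_list la < x \<Longrightarrow> flip p la x = x"
  by (induction p la x rule: flip.induct) auto

lemma flip_bounds: "p < x \<Longrightarrow> x \<le> p + sum_list la \<Longrightarrow> p < flip p la x \<and> flip p la x \<le> p + sum_list la"
proof (induction p la x rule: flip.induct)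
  case (2 p a la x)
  then show ?case by (cases "x \<le> p + a") auto
qed auto

lemma flip_flip [simp]: "flip p la (flip p la x) = x"
proof (induction p la x rule: flip.induct)
  case (2 p a la x)
  consider "p < x" "x \<le> p + a" | "x \<le> p" | "p + a < x" "x \<le> p + a + sum_list la"
    | "p + a + sum_list la < x" by linarith
  then show ?case
  proof cases
    case 3
    then show ?thesis using 2 flip_bounds[of "p + a" x la] by auto
  qed (auto simp: flip_outside)
qed auto

lemma flip_permutes: "flip p la permutes {p<..p + sum_list la}"
proof (rule bij_imp_permutes)
  show "bij_betw (flip p la) {p<..p + sum_list la} {p<..p + sum_list la}"
    by (rule bij_betw_byWitness[where f' = "flip p la"]) (auto simp: flip_bounds)
qed (auto simp: flip_outside)

text \<open>Blocks \<open>1\<close> are fixed points, so restoring the arc of a \<open>2\<close> is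
  a single transposition; in \<open>flip_3\<close> the centre stays fixed.\<close>

lemma flip_2: "flip p (2 # la) = flip p (1 # 1 # la) \<circ> transpose (p + 1) (p + 2)"
proof
  fix x
  have "x \<le> p \<or> x = p + 1 \<or> x = p + 2 \<or> p + 2 < x" by linarith
  then show "flip p (2 # la) x = (flip p (1 # 1 # la) \<circ> transpose (p + 1) (p + 2)) x"
    by (auto simp: transpose_def flip_outside eval_nat_numeral)
qed

lemma flip_3: "flip p (3 # la) = flip p (1 # 1 # 1 # la) \<circ> transpose (p + 1) (p + 3)"
proof
  fix x
  have "x \<le> p \<or> x = p + 1 \<or> x = p + 2 \<or> x = p + 3 \<or> p + 3 < x" by linarith
  then show "flip p (3 # la) x = (flip p (1 # 1 # 1 # la) \<circ> transpose (p + 1) (p + 3)) x"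
    by (auto simp: transpose_def flip_outside eval_nat_numeral)
qed

text \<open>On the common block the same reversal is applied twice and cancels; points further right
  stay to the right.\<close>

lemma flip_same: "flip p (a # la) \<circ> flip p (a # mu) = flip (p + a) la \<circ> flip (p + a) mu"
proof
  fix x
  consider "x \<le> p" | "p < x" "x \<le> p + a" | "p + a < x" by linarith
  then show "(flip p (a # la) \<circ> flip p (a # mu)) x = (flip (p + a) la \<circ> flip (p + a) mu) x"
  proof cases
    case 3
    then have "p + a < flip (p + a) mu x"
      using flip_bounds flip_outside by (metis not_le)
    with 3 show ?thesis by simp
  qed (auto simp: flip_outside)
qed

text \<open>For \<open>p = 0\<close> and equal sums this is the meander index, see
  \<open>meander_index_eq_ind\<close>. The offset allows leading blocks to be removed without
  renumbering.\<close>

definition ind :: "nat \<Rightarrow> nat list \<Rightarrow> nat list \<Rightarrow> nat" where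
  "ind p la mu = orbit_count (flip p la \<circ> flip p mu) {p<..p + sum_list la}"

lemma flip_comp_permutes:
  "sum_list la = sum_list mu \<Longrightarrow> flip p la \<circ> flip p mu permutes {p<..p + sum_list la}"
  using flip_permutes[of p la] flip_permutes[of p mu] by (simp add: permutes_compose)

lemma ind_commute:
  assumes "sum_list la = sum_list mu"
  shows "ind p la mu = ind p mu la"
  using orbit_comp_commute[of "flip p la" "{p<..p + sum_list la}" "flip p mu"]
    flip_permutes[of p la] flip_permutes[of p mu] assms
  by (simp add: ind_def orbit_count_def)

section \<open>Rules for leading blocks\<close>

lemma ind_one_one:
  assumes "sum_list la = sum_list mu"
  shows "ind p (1 # la) (1 # mu) = Suc (ind (Suc p) la mu)"
proof -
  define f where "f = flip p (1 # la) \<circ> flip p (1 # mu)"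
  have "f = flip (Suc p) la \<circ> flip (Suc p) mu"
    unfolding f_def using flip_same[of p 1] by simp
  moreover have "f permutes {p<..p + sum_list (1 # la)}"
    unfolding f_def using assms by (intro flip_comp_permutes) simp
  then have "orbit_count f {p<..p + sum_list (1 # la)} =
      Suc (orbit_count f ({p<..p + sum_list (1 # la)} - {Suc p}))"
    by (rule orbit_count_fixed_point) (auto simp: f_def)
  moreover have "{p<..p + sum_list (1 # la)} - {Suc p} = {Suc p<..Suc p + sum_list la}" by auto
  ultimately show ?thesis by (simp add: ind_def f_def)
qed

text \<open>The transposition is the arc by which \<open>mu\<close> and \<open>mu'\<close> differ.
  As \<open>x\<close> is fixed by both \<open>flip p la\<close> and \<open>flip p mu'\<close>,
  \<open>orbit_count_transpose\<close> applies to their composition.\<close>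

lemma ind_merge:
  assumes "sum_list la = sum_list mu" "sum_list mu' = sum_list mu"
    and "flip p mu = flip p mu' \<circ> transpose x y"
    and "flip p la x = x" "flip p mu' x = x" "x \<noteq> y"
    and "p < x" "x \<le> p + sum_list la" "p < y" "y \<le> p + sum_list la"
  shows "ind p la mu' = Suc (ind p la mu)"
proof -
  have "flip p la \<circ> flip p mu' permutes {p<..p + sum_list la}"
    using assms by (intro flip_comp_permutes) simp
  then show ?thesis
    unfolding ind_def using assms orbit_count_transpose[of "flip p la \<circ> flip p mu'" _ x y]
    by (simp add: comp_assoc)
qed

text \<open>Splitting the \<open>2\<close> into \<open>1, 1\<close> adds one orbit, since the
  opposite block \<open>1\<close> fixes \<open>p + 1\<close>; removing the equal leading blocks
  \<open>1\<close> takes one away. The same balance gives \<open>ind_1_3\<close>.\<close>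

lemma ind_1_2:
  assumes "sum_list (1 # la) = sum_list (2 # mu)"
  shows "ind p (1 # la) (2 # mu) = ind (Suc p) la (1 # mu)"
  using ind_merge[OF _ _ flip_2, of "1 # la" mu p] ind_one_one[of la "1 # mu" p] assms by simp

lemma ind_1_3:
  assumes "sum_list (1 # la) = sum_list (3 # mu)"
  shows "ind p (1 # la) (3 # mu) = ind (Suc p) la (1 # 1 # mu)"
  using ind_merge[OF _ _ flip_3, of "1 # la" mu p] ind_one_one[of la "1 # 1 # mu" p] assms by simp

lemma ind_11_2:
  assumes "sum_list (1 # 1 # la) = sum_list (2 # mu)"
  shows "ind p (1 # 1 # la) (2 # mu) = Suc (ind (Suc (Suc p)) la mu)"
  using ind_1_2[of "1 # la" mu p] ind_one_one[of la mu "Suc p"] assms by simp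

lemma ind_11_3:
  assumes "sum_list (1 # 1 # la) = sum_list (3 # mu)"
  shows "ind p (1 # 1 # la) (3 # mu) = Suc (ind (Suc (Suc p)) la (1 # mu))"
  using ind_1_3[of "1 # la" mu p] ind_one_one[of la "1 # mu" "Suc p"] assms by simp

lemma ind_2_3:
  assumes "sum_list (2 # la) = sum_list (3 # mu)"
  shows "ind p (2 # la) (3 # mu) = ind (Suc (Suc p)) la (1 # mu)"
proof -
  \<comment> \<open>The fixed point needed for \<open>ind_merge\<close> is now the centre of the
    \<open>3\<close>, so it is the \<open>2\<close> that gets split, with \<open>p + 2\<close> as
    first point of the transposition.\<close>
  have "flip p (3 # mu) (p + 2) = p + 2" by simp
  then have "Suc (ind p (3 # mu) (2 # la)) = ind p (3 # mu) (1 # 1 # la)"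
    using ind_merge[of "3 # mu" "2 # la" "1 # 1 # la" p "p + 2" "p + 1"]
      flip_2[of p la] transpose_commute[of "p + 1" "p + 2"] assms by simp
  then show ?thesis
    using ind_11_3[of la mu p] ind_commute[of "3 # mu" "2 # la" p]
      ind_commute[of "3 # mu" "1 # 1 # la" p] assms by simp
qed

lemma ind_cong:
  assumes "flip p la \<circ> flip p mu = flip p la' \<circ> flip p mu'" "sum_list la = sum_list la'"
  shows "ind p la mu = ind p la' mu'"
  using assms by (simp add: ind_def)

text \<open>A common leading block cancels by \<open>flip_same\<close>, so it can be exchanged for
  \<open>1, 1\<close> on both sides, and each pair of blocks \<open>1\<close> contributes one orbit.
  \<open>ind_3_3\<close> exchanges \<open>3\<close> for \<open>1, 2\<close> likewise.\<close>

lemma ind_2_2: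
  assumes "sum_list la = sum_list mu"
  shows "ind p (2 # la) (2 # mu) = 2 + ind (Suc (Suc p)) la mu"
proof -
  have "ind p (2 # la) (2 # mu) = ind p (1 # 1 # la) (1 # 1 # mu)"
    by (rule ind_cong) (simp_all only: flip_same, simp_all)
  then show ?thesis
    using ind_one_one[of "1 # la" "1 # mu" p] ind_one_one[of la mu "Suc p"] assms by simp
qed

lemma ind_3_3:
  assumes "sum_list la = sum_list mu"
  shows "ind p (3 # la) (3 # mu) = 3 + ind (Suc (Suc (Suc p))) la mu"
proof -
  have "ind p (3 # la) (3 # mu) = ind p (1 # 2 # la) (1 # 2 # mu)"
    by (rule ind_cong) (simp_all only: flip_same, simp_all add: eval_nat_numeral)
  then show ?thesis
    using ind_one_one[of "2 # la" "2 # mu" p] ind_2_2[of la mu "Suc p"] assms by simp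
qed

section \<open>Translating and scaling\<close>

lemma flip_translate: "flip (p + q) la (x + q) = flip p la x + q"
proof (induction p la x rule: flip.induct)
  case (2 p a la x)
  then show ?case by (auto simp: algebra_simps)
qed simp

lemma ind_translate:
  assumes "sum_list la = sum_list mu"
  shows "ind p la mu = ind 0 la mu"
proof -
  define f where "f = flip 0 la \<circ> flip 0 mu"
  define g where "g = flip p la \<circ> flip p mu"
  define S where "S = {0<..0 + sum_list la}"
  have f: "f permutes S" and fin: "finite S"
    using flip_comp_permutes[OF assms, of 0] by (simp_all add: f_def S_def)
  have "g (x + p) = f x + p" for x
    using flip_translate[of 0 p] by (simp add: f_def g_def)
  then have orb: "orbit g (x + p) = (\<lambda>x. x + p) ` orbit f x" if "x \<in> S" for x
    using orbit_image[OF f fin that, of g "\<lambda>x. x + p"] by simp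
  have "{p<..p + sum_list la} = (\<lambda>x. x + p) ` S"
  proof (intro equalityI subsetI)
    fix x assume "x \<in> {p<..p + sum_list la}"
    then show "x \<in> (\<lambda>x. x + p) ` S"
      by (intro image_eqI[of _ _ "x - p"]) (auto simp: S_def)
  qed (auto simp: S_def)
  then have "orbit g ` {p<..p + sum_list la} = (\<lambda>A. (\<lambda>x. x + p) ` A) ` (orbit f ` S)"
    using orb by (auto simp: image_image)
  moreover have "inj (\<lambda>A. (\<lambda>x. x + p) ` A)"
    by (intro injI) (simp add: inj_image_eq_iff)
  ultimately show ?thesis
    using card_image[of "\<lambda>A. (\<lambda>x. x + p) ` A" "orbit f ` S"] inj_on_subset[OF _ subset_UNIV]
    unfolding ind_def orbit_count_def f_def[symmetric] g_def[symmetric] S_def[symmetric] by metis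
qed

text \<open>Vertex \<open>u\<close> of a meander corresponds to the vertices \<open>c * u - r\<close>, \<open>r < c\<close>, of the meander
  scaled by \<open>c\<close>. Each arc reverses \<open>r\<close>, so the composition of two arcs preserves it.\<close>

lemma flip_scale:
  assumes "r < c" "p < u" "u \<le> p + sum_list la"
  shows "flip (c * p) (map ((*) c) la) (c * u - r) = c * flip p la u - (c - 1 - r)"
  using assms(2,3)
proof (induction la arbitrary: p)
  case (Cons a la)
  have le: "c * x + c \<le> c * y" if "x < y" for x y :: nat
    using that mult_le_mono2[of "Suc x" y c] by simp
  \<comment> \<open>\<open>U\<close>, \<open>W\<close>, \<open>P\<close>, \<open>A\<close> stand for
    \<open>c * u\<close>, \<open>c * w\<close>, \<open>c * p\<close>, \<open>c * a\<close>; with the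
    products abstracted the claim is linear.\<close>
  have arith: "P < U - r \<and> U - r \<le> P + A \<and> 2 * P + A + 1 - (U - r) = W - (c - 1 - r)"
    if "U + W = 2 * P + A + c" "P + c \<le> U" "c \<le> W" "U \<le> P + A" for U W P A
    using that assms(1) by linarith
  show ?case
  proof (cases "u \<le> p + a")
    case True
    define w where "w = 2 * p + a + 1 - u"
    have "u + w = 2 * p + a + 1" and w: "0 < w" using True by (auto simp: w_def)
    then have "c * (u + w) = c * (2 * p + a + 1)" by simp
    then have "c * u + c * w = 2 * (c * p) + c * a + c" by (simp add: algebra_simps)
    moreover have "c * p + c \<le> c * u" "c \<le> c * w"
      using le[of p u] Cons.prems w by simp_all
    moreover have "c * u \<le> c * p + c * a" using True by (metis distrib_left mult_le_mono2)
    ultimately have "flip (c * p) (map ((*) c) (a # la)) (c * u - r) = c * w - (c - 1 - r)"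
      using arith[of "c * u" "c * w" "c * p" "c * a"] by simp
    moreover have "flip p (a # la) u = w" using True Cons.prems by (simp add: w_def)
    ultimately show ?thesis by simp
  next
    case False
    then have "c * (p + a) + c \<le> c * u" by (intro le) simp
    then have "\<not> c * u - r \<le> c * p + c * a" using assms(1) by (simp add: algebra_simps)
    then have "flip (c * p) (map ((*) c) (a # la)) (c * u - r) =
        flip (c * (p + a)) (map ((*) c) la) (c * u - r)"
      by (simp add: distrib_left)
    then show ?thesis using Cons.IH[of "p + a"] Cons.prems False by simp
  qed
qed simp

text \<open>Division by \<open>c\<close> with the remainder counted down from the next multiple.
  Positivity excludes \<open>u = 0\<close>, where truncated subtraction gives \<open>0\<close> for
  every \<open>r\<close>.\<close>

lemma scale_inj:
  fixes c u v q r :: nat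
  assumes "c * u - r = c * v - q" "r < c" "q < c" "0 < u" "0 < v"
  shows "u = v \<and> r = q"
proof -
  have le: "c * x + c \<le> c * y" if "x < y" for x y :: nat
    using that mult_le_mono2[of "Suc x" y c] by simp
  have cu: "c \<le> c * u" "c \<le> c * v" using le[of 0] assms by auto
  have "\<not> u < v" "\<not> v < u"
    using le[of u v] le[of v u] cu assms(1-3) by linarith+
  then have "u = v" by simp
  moreover have "c * u - r = c * u - q" using assms(1) \<open>u = v\<close> by simp
  then have "r = q" using cu(1) assms(2,3) by linarith
  ultimately show ?thesis by simp
qed

text \<open>For each \<open>r < c\<close> the map \<open>h r\<close> carries orbits of
  \<open>f\<close> to orbits of \<open>g\<close>. The images of \<open>S\<close> under these maps
  partition the scaled vertex set, so every orbit appears in \<open>c\<close> copies.\<close>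

lemma ind_scale:
  assumes c: "0 < c" and sums: "sum_list la = sum_list mu"
  shows "ind 0 (map ((*) c) la) (map ((*) c) mu) = c * ind 0 la mu"
proof -
  define S where "S = {0<..0 + sum_list la}"
  define f where "f = flip 0 la \<circ> flip 0 mu"
  define g where "g = flip 0 (map ((*) c) la) \<circ> flip 0 (map ((*) c) mu)"
  define h where "h r u = c * u - r" for r u
  have f: "f permutes S" and fin: "finite S"
    using flip_comp_permutes[OF sums, of 0] by (simp_all add: f_def S_def)
  have "g (h r u) = h r (f u)" if "r < c" "u \<in> S" for r u
  proof -
    have "flip 0 mu u \<in> S" using that flip_bounds[of 0 u mu] sums by (simp add: S_def)
    then show ?thesis
      using that flip_scale[of r c 0 u mu] flip_scale[of "c - 1 - r" c 0 "flip 0 mu u" la] sums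
      by (simp add: f_def g_def h_def S_def)
  qed
  then have orb: "orbit g (h r u) = h r ` orbit f u" if "r < c" "u \<in> S" for r u
    using that by (intro orbit_image[OF f fin]) auto
  have "{0<..0 + sum_list (map ((*) c) la)} = (\<lambda>(r, u). h r u) ` ({..<c} \<times> S)"
  proof (intro equalityI subsetI)
    fix x assume "x \<in> {0<..0 + sum_list (map ((*) c) la)}"
    then have x: "0 < x" "x \<le> c * sum_list la" by (simp_all add: sum_list_const_mult)
    \<comment> \<open>This is \<open>x / c\<close> rounded up; \<open>c * u - x\<close> is the
      matching \<open>r\<close>.\<close>
    define u where "u = (x - 1) div c + 1"
    have "c * ((x - 1) div c) \<le> x - 1" "x - 1 < c * ((x - 1) div c) + c"
      using c dividend_less_times_div[of c "x - 1"] times_div_less_eq_dividend[of c "x - 1"]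
      by (simp_all only: add.commute)
    moreover have "c * u = c * ((x - 1) div c) + c" by (simp add: u_def)
    ultimately have ux: "x \<le> c * u" "c * u < x + c" using x by linarith+
    have "c * u < c * (sum_list la + 1)" using ux x by simp
    then have "u \<in> S" unfolding S_def by (simp add: u_def)
    moreover have "x = h (c * u - x) u" "c * u - x < c" using ux by (simp_all add: h_def)
    ultimately show "x \<in> (\<lambda>(r, u). h r u) ` ({..<c} \<times> S)" by force
  next
    fix x assume "x \<in> (\<lambda>(r, u). h r u) ` ({..<c} \<times> S)"
    then obtain r u where ru: "r < c" "0 < u" "u \<le> sum_list la" "x = c * u - r"
      by (auto simp: h_def S_def)
    then have "c \<le> c * u" "c * u \<le> c * sum_list la" by simp_all
    then have "r < c * u" "c * u - r \<le> c * sum_list la" using ru(1) by linarith+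
    then show "x \<in> {0<..0 + sum_list (map ((*) c) la)}"
      using ru by (simp add: sum_list_const_mult)
  qed
  then have "orbit g ` {0<..0 + sum_list (map ((*) c) la)} =
      (\<lambda>p. orbit g (h (fst p) (snd p))) ` ({..<c} \<times> S)"
    by (simp add: image_image case_prod_beta)
  also have "\<dots> = (\<lambda>p. h (fst p) ` orbit f (snd p)) ` ({..<c} \<times> S)"
    by (rule image_cong) (use orb in auto)
  also have "\<dots> = (\<lambda>(r, A). h r ` A) ` (map_prod id (orbit f) ` ({..<c} \<times> S))"
    by (simp add: image_image case_prod_beta)
  also have "map_prod id (orbit f) ` ({..<c} \<times> S) = {..<c} \<times> orbit f ` S"
    by (rule map_prod_surj_on) simp_all
  finally have "orbit g ` {0<..0 + sum_list (map ((*) c) la)} =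
      (\<lambda>(r, A). h r ` A) ` ({..<c} \<times> orbit f ` S)" .
  moreover have "inj_on (\<lambda>(r, A). h r ` A) ({..<c} \<times> orbit f ` S)"
  proof (rule inj_onI, clarsimp)
    fix r u q v
    assume r: "r < c" and u: "u \<in> S" and q: "q < c" and v: "v \<in> S"
      and eq: "h r ` orbit f u = h q ` orbit f v"
    have sub: "orbit f u \<subseteq> S" "orbit f v \<subseteq> S"
      using permutes_orbit_subset[OF f] u v by auto
    have inj: "x = y \<and> r = q" if "h r x = h q y" "x \<in> S" "y \<in> S" for x y
      using scale_inj[of c x r y q] that r q unfolding h_def S_def by simp
    \<comment> \<open>A single common point forces \<open>r = q\<close>, and then \<open>h r\<close>
      is injective on \<open>S\<close>.\<close>
    obtain y where "y \<in> orbit f v" "h r u = h q y"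
      using eq self_in_orbit[OF f fin, of u] by blast
    then have "r = q" using inj[of u y] u sub by blast
    moreover have "inj_on (h r) S"
      using inj \<open>r = q\<close> by (blast intro: inj_onI)
    then have "orbit f u = orbit f v"
      using eq sub inj_on_image_eq_iff[of "h r" S] \<open>r = q\<close> by simp
    ultimately show "r = q \<and> orbit f u = orbit f v" by simp
  qed
  ultimately have "card (orbit g ` {0<..0 + sum_list (map ((*) c) la)}) = c * card (orbit f ` S)"
    by (simp add: card_image card_cartesian_product)
  then show ?thesis
    by (simp add: ind_def orbit_count_def f_def g_def S_def)
qed

section \<open>Components of meanders\<close>

definition arcs :: "nat set \<Rightarrow> (nat \<Rightarrow> nat) \<Rightarrow> nat set set" where
  "arcs V s = {{v, s v} | v. v \<in> V \<and> s v \<noteq> v}"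

lemma arcs_Un: "arcs (V \<union> W) s = arcs V s \<union> arcs W s"
  by (auto simp: arcs_def)

lemma arcs_cong: "(\<And>v. v \<in> V \<Longrightarrow> s v = t v) \<Longrightarrow> arcs V s = arcs V t"
  unfolding arcs_def by force

lemma block_arcs_eq_arcs: "block_arcs p la = arcs {p<..p + sum_list la} (flip p la)"
proof (induction p la rule: block_arcs.induct)
  case (1 p)
  then show ?case by (simp add: arcs_def)
next
  case (2 p a la)
  have "{{p + i, p + a + 1 - i} | i. 1 \<le> i \<and> i \<le> a div 2} = arcs {p<..p + a} (flip p (a # la))"
  proof (intro equalityI subsetI)
    fix e assume "e \<in> {{p + i, p + a + 1 - i} | i. 1 \<le> i \<and> i \<le> a div 2}"
    then obtain i where i: "1 \<le> i" "i \<le> a div 2" "e = {p + i, p + a + 1 - i}" by blast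
    then have "flip p (a # la) (p + i) = p + a + 1 - i" "p + i \<noteq> p + a + 1 - i"
      by auto
    with i show "e \<in> arcs {p<..p + a} (flip p (a # la))"
      unfolding arcs_def by (intro CollectI exI[of _ "p + i"]) auto
  next
    fix e assume "e \<in> arcs {p<..p + a} (flip p (a # la))"
    then obtain v where v: "p < v" "v \<le> p + a" "e = {v, 2 * p + a + 1 - v}" "2 * p + a + 1 - v \<noteq> v"
      by (auto simp: arcs_def split: if_splits)
    \<comment> \<open>The index \<open>i\<close> belongs to the left end of the arc: this is
      \<open>v\<close> in the left half of the block and its mirror image otherwise.\<close>
    show "e \<in> {{p + i, p + a + 1 - i} | i. 1 \<le> i \<and> i \<le> a div 2}"
    proof (cases "v - p \<le> a div 2")
      case True
      with v show ?thesis by (intro CollectI exI[of _ "v - p"]) auto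
    next
      case False
      with v show ?thesis by (intro CollectI exI[of _ "p + a + 1 - v"]) auto
    qed
  qed
  moreover have "arcs {p + a<..p + a + sum_list la} (flip (p + a) la) =
      arcs {p + a<..p + a + sum_list la} (flip p (a # la))"
    by (rule arcs_cong) auto
  moreover have "{p<..p + sum_list (a # la)} = {p<..p + a} \<union> {p + a<..p + a + sum_list la}"
    by auto
  ultimately show ?case
    using 2 by (simp only: block_arcs.simps arcs_Un)
qed

text \<open>The labels are parameters so that the roles of \<open>s\<close> and \<open>t\<close> can
  be exchanged, see \<open>two_involutions_swap\<close>.\<close>

locale two_involutions =
  fixes V :: "nat set" and s t :: "nat \<Rightarrow> nat" and a b :: side
  assumes fin: "finite V"
    and s: "s permutes V" "\<And>x. s (s x) = x"
    and t: "t permutes V" "\<And>x. t (t x) = x"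
    and ab: "a \<noteq> b"
begin

definition E :: "edge set" where
  "E = {a} \<times> arcs V s \<union> {b} \<times> arcs V t"

lemma in_V [simp]: "s x \<in> V \<longleftrightarrow> x \<in> V" "t x \<in> V \<longleftrightarrow> x \<in> V"
  using s t by (simp_all add: permutes_in_image)

lemma adjacent_iff: "(u, v) \<in> adjacency E \<longleftrightarrow> u \<in> V \<and> u \<noteq> v \<and> (v = s u \<or> v = t u)"
proof
  assume "(u, v) \<in> adjacency E"
  then show "u \<in> V \<and> u \<noteq> v \<and> (v = s u \<or> v = t u)"
    by (auto simp: adjacency_def E_def arcs_def doubleton_eq_iff s(2) t(2))
next
  assume "u \<in> V \<and> u \<noteq> v \<and> (v = s u \<or> v = t u)"
  then have "{u, v} \<in> arcs V s \<or> {u, v} \<in> arcs V t"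
    by (fastforce simp: arcs_def)
  then show "(u, v) \<in> adjacency E"
    by (auto simp: adjacency_def E_def)
qed

definition component :: "nat \<Rightarrow> nat set" where
  "component v = {u. (v, u) \<in> (adjacency E)\<^sup>*}"

lemma component_refl [simp]: "v \<in> component v"
  by (simp add: component_def)

lemma component_closed:
  assumes "v \<in> V" "u \<in> component v"
  shows "u \<in> V" "s u \<in> component v" "t u \<in> component v"
proof -
  have vu: "(v, u) \<in> (adjacency E)\<^sup>*" using assms by (simp add: component_def)
  then show u: "u \<in> V"
    using assms(1) by induction (auto simp: adjacent_iff)
  have "s u \<noteq> u \<Longrightarrow> (u, s u) \<in> adjacency E" "t u \<noteq> u \<Longrightarrow> (u, t u) \<in> adjacency E"
    using u by (auto simp: adjacent_iff)
  then show "s u \<in> component v" "t u \<in> component v"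
    using vu unfolding component_def by (auto dest: rtrancl_into_rtrancl) (metis rtrancl_into_rtrancl)+
qed

lemma component_least:
  assumes "v \<in> C" "\<And>u. u \<in> C \<Longrightarrow> s u \<in> C \<and> t u \<in> C"
  shows "component v \<subseteq> C"
proof
  fix u assume "u \<in> component v"
  then have "(v, u) \<in> (adjacency E)\<^sup>*" by (simp add: component_def)
  then show "u \<in> C"
    using assms by induction (auto simp: adjacent_iff)
qed

lemma sym_adjacency: "sym ((adjacency E)\<^sup>*)"
  by (intro sym_rtrancl symI) (auto simp: adjacency_def insert_commute)

lemma component_eq: "u \<in> component v \<Longrightarrow> component u = component v"
  using sym_adjacency unfolding component_def by (auto dest: symD intro: rtrancl_trans)

lemma components_eq: "components V E = component ` V"
proof -
  have "{(u, v). u \<in> V \<and> v \<in> V \<and> (u, v) \<in> (adjacency E)\<^sup>*} `` {v} = component v" if "v \<in> V" for v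
    using that component_closed(1)[OF that] by (auto simp: component_def)
  then show ?thesis
    unfolding components_def quotient_def by (simp add: UNION_singleton_eq_range)
qed

section \<open>Orbits inside a component\<close>

lemma orbit_subset_comp:
  assumes "v \<in> V" "u \<in> component v"
  shows "orbit (s \<circ> t) u \<subseteq> component v"
proof
  fix x assume "x \<in> orbit (s \<circ> t) u"
  then show "x \<in> component v"
    by induction (use assms component_closed in auto)
qed

lemma st_permutes: "(s \<circ> t) permutes V"
  using s t by (simp add: permutes_compose)

lemmas st_self = self_in_orbit[OF st_permutes fin]
lemmas st_orbit_eq = orbit_eq_if_mem[OF st_permutes fin]

text \<open>\<open>s\<close> conjugates \<open>s \<circ> t\<close> to its inverse, hence maps orbits
  to orbits. For \<open>t_orbit\<close>, note that \<open>s \<circ> t\<close> maps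
  \<open>t x\<close> to \<open>s x\<close>.\<close>

lemma s_orbit: "x \<in> orbit (s \<circ> t) u \<Longrightarrow> s x \<in> orbit (s \<circ> t) (s u)"
proof (induction rule: orbit.induct)
  case base
  have "s u \<in> orbit (s \<circ> t) (t u)" using orbit.base[of "s \<circ> t" "t u"] by (simp add: t)
  then show ?case using st_orbit_eq st_self s(2) by (metis comp_apply)
next
  case (step x)
  have "s x \<in> orbit (s \<circ> t) (t x)" using orbit.base[of "s \<circ> t" "t x"] by (simp add: t)
  then have "orbit (s \<circ> t) (t x) = orbit (s \<circ> t) (s x)" using st_orbit_eq by metis
  then show ?case using step.IH st_orbit_eq st_self[of "t x"] s(2) by (metis comp_apply)
qed

lemma t_orbit: "x \<in> orbit (s \<circ> t) u \<Longrightarrow> t x \<in> orbit (s \<circ> t) (s u)"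
  using orbit.base[of "s \<circ> t" "t x"] s_orbit[of x u] st_orbit_eq st_self
  by (metis comp_apply t(2))

text \<open>\<open>s\<close> and \<open>t\<close> map each of the two orbits into the other one, so
  their union is closed under both involutions.\<close>

lemma component_eq_orbits:
  assumes "v \<in> V"
  shows "component v = orbit (s \<circ> t) v \<union> orbit (s \<circ> t) (s v)"
proof
  show "component v \<subseteq> orbit (s \<circ> t) v \<union> orbit (s \<circ> t) (s v)"
  proof (rule component_least)
    fix u assume "u \<in> orbit (s \<circ> t) v \<union> orbit (s \<circ> t) (s v)"
    then show "s u \<in> orbit (s \<circ> t) v \<union> orbit (s \<circ> t) (s v) \<and> t u \<in> orbit (s \<circ> t) v \<union> orbit (s \<circ> t) (s v)"
      using s_orbit[of u v] s_orbit[of u "s v"] t_orbit[of u v] t_orbit[of u "s v"] by (auto simp: s)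
  qed (use st_self in auto)
  show "orbit (s \<circ> t) v \<union> orbit (s \<circ> t) (s v) \<subseteq> component v"
    using assms orbit_subset_comp component_closed(2)[OF assms] by simp
qed

lemma orbits_in_comp:
  assumes "v \<in> V"
  shows "orbit (s \<circ> t) ` component v = {orbit (s \<circ> t) v, orbit (s \<circ> t) (s v)}"
proof -
  have "orbit (s \<circ> t) u \<in> {orbit (s \<circ> t) v, orbit (s \<circ> t) (s v)}" if "u \<in> component v" for u
    using that component_eq_orbits[OF assms] st_orbit_eq by blast
  moreover have "v \<in> component v" "s v \<in> component v"
    using component_closed(2)[OF assms] by simp_all
  ultimately show ?thesis by blast
qed

text \<open>If \<open>t v = v\<close>, then \<open>s v\<close> is the image of \<open>v\<close>
  under \<open>s \<circ> t\<close>; if \<open>s v = v\<close>, the two orbits agree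
  trivially.\<close>

lemma orbits_fixed_point:
  assumes "v \<in> V" "s v = v \<or> t v = v"
  shows "card (orbit (s \<circ> t) ` component v) = 1"
proof -
  have "orbit (s \<circ> t) (s v) = orbit (s \<circ> t) v"
    using assms(2) orbit.base[of "s \<circ> t" v] st_orbit_eq[of "s v" v] by auto
  then show ?thesis using orbits_in_comp[OF assms(1)] by simp
qed

lemma s_funpow: "((s \<circ> t) ^^ i) (s (((s \<circ> t) ^^ i) x)) = s x"
proof (induction i)
  case (Suc i)
  have "((s \<circ> t) ^^ Suc i) (s (((s \<circ> t) ^^ Suc i) x)) =
      ((s \<circ> t) ^^ i) ((s \<circ> t) (s ((s \<circ> t) (((s \<circ> t) ^^ i) x))))"
    by (simp add: funpow_swap1)
  also have "(s \<circ> t) (s ((s \<circ> t) y)) = s y" for y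
    by (simp add: s t)
  finally show ?case using Suc by (rule trans)
qed simp

text \<open>If the two orbits met, \<open>s\<close> would reflect the orbit segment from
  \<open>v\<close> to \<open>s v\<close>. Its midpoint \<open>u\<close> would then be fixed by
  \<open>s\<close> or by \<open>t\<close>, according to the parity of the length
  \<open>n\<close>.\<close>

lemma orbits_no_fixed_point:
  assumes v: "v \<in> V" and no: "\<And>u. u \<in> component v \<Longrightarrow> s u \<noteq> u \<and> t u \<noteq> u"
  shows "card (orbit (s \<circ> t) ` component v) = 2"
proof -
  define r where "r = s \<circ> t"
  have r: "inj (r ^^ i)" for i
    using st_permutes unfolding r_def by (intro inj_fn) (rule permutes_inj)
  have "orbit r (s v) \<noteq> orbit r v"
  proof
    assume "orbit r (s v) = orbit r v"
    then have "s v \<in> orbit r v" using st_self r_def by metis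
    then obtain n where n: "s v = (r ^^ n) v"
      by (auto simp: orbit_altdef)
    define j u where "j = n div 2" and "u = (r ^^ j) v"
    have "u \<in> component v"
      unfolding u_def r_def by (induction j) (use component_closed[OF v] in auto)
    have sv: "s v = (r ^^ j) (s u)"
      using s_funpow unfolding u_def r_def by metis
    show False
    proof (cases "even n")
      case True
      then have "n = j + j" by (auto simp: j_def)
      then have "(r ^^ j) (s u) = (r ^^ j) u"
        using n sv by (simp add: funpow_add u_def)
      then have "s u = u" using r injD by metis
      then show False using no \<open>u \<in> component v\<close> by blast
    next
      case False
      then have "n = j + (1 + j)" by (simp add: j_def) presburger
      then have "(r ^^ j) (s u) = (r ^^ j) (r u)"
        using n sv by (simp add: funpow_add u_def funpow_swap1)
      then have "s u = s (t u)" using r injD unfolding r_def by (metis comp_apply)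
      then have "t u = u" using s(2) by metis
      then show False using no \<open>u \<in> component v\<close> by blast
    qed
  qed
  then show ?thesis using orbits_in_comp[OF v] unfolding r_def by auto
qed

section \<open>Alternating walks along a component\<close>

primrec walk :: "nat \<Rightarrow> nat \<Rightarrow> nat" where
  "walk v 0 = v"
| "walk v (Suc i) = (if even i then t (walk v i) else s (walk v i))"

lemma walk_in_comp: "v \<in> V \<Longrightarrow> walk v i \<in> component v"
  by (induction i) (auto simp: component_closed)

lemma walk_back: "even i \<Longrightarrow> t (walk v (Suc i)) = walk v i" "odd i \<Longrightarrow> s (walk v (Suc i)) = walk v i"
  by (simp_all add: s t)

text \<open>Take the first \<open>j\<close> that repeats an earlier vertex. With equal parities both
  were entered by the same involution, and stepping back gives an earlier repetition unless
  \<open>i = 0\<close>. With different parities the step out of \<open>i\<close> uses the involution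
  that led into \<open>j\<close>, so \<open>walk v (Suc i) = walk v (j - 1)\<close> is an earlier
  repetition unless \<open>Suc i = j\<close>; parity excludes \<open>Suc i = j - 1\<close>.\<close>

lemma walk_repeat:
  assumes v: "v \<in> V"
  obtains i j where "i < j" "walk v i = walk v j" "inj_on (walk v) {..<j}" "Suc i = j \<or> i = 0 \<and> even j"
proof -
  define P where "P j \<longleftrightarrow> (\<exists>i<j. walk v i = walk v j)" for j
  have "\<exists>j. P j"
  proof (rule ccontr)
    assume "\<nexists>j. P j"
    then have "inj (walk v)"
      unfolding P_def by (intro injI) (metis linorder_neqE_nat)
    moreover have "range (walk v) \<subseteq> V"
      using walk_in_comp[OF v] component_closed(1)[OF v] by auto
    ultimately show False
      using fin finite_subset finite_imageD by blast
  qed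
  then obtain j where j: "P j" and least: "\<And>k. k < j \<Longrightarrow> \<not> P k"
    using exists_least_iff[of P] by auto
  have inj: "inj_on (walk v) {..<j}"
    using least unfolding P_def by (intro inj_onI) (metis lessThan_iff linorder_neqE_nat)
  obtain i where i: "i < j" "walk v i = walk v j" using j P_def by auto
  obtain j' where j': "j = Suc j'" using i by (cases j) auto
  have "Suc i = j \<or> i = 0 \<and> even j"
  proof (cases "even i = even j")
    case True
    have "i = 0"
    proof (rule ccontr)
      assume "i \<noteq> 0"
      then obtain i' where i': "i = Suc i'" by (cases i) auto
      have "walk v i' = walk v j'"
        using walk_back[of i' v] walk_back[of j' v] i(2) True unfolding i' j'
        by (metis even_Suc)
      then show False using least[of j'] i i' j' P_def by auto
    qed
    then show ?thesis using True by auto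
  next
    case False
    have "walk v (Suc i) = walk v j'"
      using walk_back[of j' v] i(2) False unfolding j' by (metis even_Suc walk.simps(2))
    moreover have "Suc i < j' \<Longrightarrow> P j'" if "walk v (Suc i) = walk v j'"
      using that P_def by auto
    ultimately have "\<not> Suc i < j'" using least[of j'] j' by auto
    then have "i = j' \<or> Suc i = j'" using i j' by auto
    moreover have "Suc i \<noteq> j'" using False j' by auto
    ultimately show ?thesis using j' by auto
  qed
  with i inj that show thesis by blast
qed

lemma edges_within_comp:
  assumes v: "v \<in> V"
  shows "edges_within E (component v) =
    {(b, {u, t u}) | u. u \<in> component v \<and> t u \<noteq> u} \<union> {(a, {u, s u}) | u. u \<in> component v \<and> s u \<noteq> u}"
  unfolding edges_within_def E_def arcs_def using component_closed[OF v] by auto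

definition step_edge :: "nat \<Rightarrow> nat \<Rightarrow> edge" where
  "step_edge v i = (if even i then b else a, {walk v i, walk v (Suc i)})"

text \<open>The last two equations read the edge from its far end; they cover the edge by which the
  walk entered a vertex.\<close>

lemma step_edge_simps:
  "even i \<Longrightarrow> step_edge v i = (b, {walk v i, t (walk v i)})"
  "odd i \<Longrightarrow> step_edge v i = (a, {walk v i, s (walk v i)})"
  "even i \<Longrightarrow> step_edge v i = (b, {walk v (Suc i), t (walk v (Suc i))})"
  "odd i \<Longrightarrow> step_edge v i = (a, {walk v (Suc i), s (walk v (Suc i))})"
  by (auto simp: step_edge_def s t)

lemma step_edge_within:
  assumes "v \<in> V" "walk v (Suc i) \<noteq> walk v i"
  shows "step_edge v i \<in> edges_within E (component v)"
  using assms walk_in_comp[OF assms(1)] by (auto simp: edges_within_comp step_edge_def)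

text \<open>The walk leaves the end \<open>v\<close> of the path by \<open>t\<close> and stops at
  the other end, where the next step is stationary.\<close>

lemma path_if_fixed:
  assumes v: "v \<in> V" and fixed: "s v = v"
  shows "is_path E (component v)"
proof -
  obtain i j where ij: "i < j" "walk v i = walk v j" and inj: "inj_on (walk v) {..<j}"
    and *: "Suc i = j \<or> i = 0 \<and> even j"
    using walk_repeat[OF v] .
  \<comment> \<open>A closed walk would return to \<open>v\<close> by \<open>s\<close>; as
    \<open>s\<close> fixes \<open>v\<close>, it would have been at \<open>v\<close> one step
    earlier.\<close>
  have j: "j = Suc i"
  proof (rule ccontr)
    assume "j \<noteq> Suc i"
    with * have **: "i = 0" "even j" by auto
    with ij obtain j' where j': "j = Suc j'" "odd j'" by (cases j) auto
    then have "walk v j' = walk v 0"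
      using walk_back(2)[of j' v] ij ** fixed by simp
    then show False using inj j' by (auto dest!: inj_onD[of _ _ j' 0])
  qed
  have v0: "v \<in> walk v ` {..<j}"
    using ij by (intro image_eqI[of _ _ 0]) simp_all
  have C: "component v = walk v ` {..<j}"
  proof
    show "component v \<subseteq> walk v ` {..<j}"
    proof (rule component_least)
      show "v \<in> walk v ` {..<j}" by (rule v0)
    next
      fix u assume "u \<in> walk v ` {..<j}"
      then obtain k where k: "k < j" "u = walk v k" by auto
      \<comment> \<open>The step out of the last vertex \<open>walk v i\<close> is
        stationary.\<close>
      have nx: "walk v (Suc k) \<in> walk v ` {..<j}"
      proof (cases "k = i")
        case True
        then show ?thesis using ij j by (metis imageI lessThan_iff)
      next
        case False
        with k j have "Suc k < j" by simp
        then show ?thesis by (intro imageI) simp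
      qed
      have prev: "k = 0 \<or> (\<exists>l<j. k = Suc l)" using k by (cases k) auto
      show "s u \<in> walk v ` {..<j} \<and> t u \<in> walk v ` {..<j}"
      proof (cases "even k")
        case True
        have "s u \<in> walk v ` {..<j}"
        proof (cases k)
          case 0
          then show ?thesis using k fixed v0 by simp
        next
          case (Suc l)
          then show ?thesis using k True walk_back(2)[of l v] by auto
        qed
        then show ?thesis using True nx k by simp
      next
        case False
        then obtain l where "k = Suc l" "even l" by (cases k) auto
        then have "t u \<in> walk v ` {..<j}" using k walk_back(1)[of l v] by auto
        then show ?thesis using False nx k by simp
      qed
    qed
    show "walk v ` {..<j} \<subseteq> component v" using walk_in_comp[OF v] by auto
  qed
  define vs es where "vs = map (walk v) [0..<j]" and "es = map (step_edge v) [0..<i]"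
  have "distinct vs"
    using inj by (simp add: vs_def distinct_map lessThan_atLeast0)
  moreover have "set vs = component v"
    using C by (simp add: vs_def lessThan_atLeast0)
  moreover have "distinct es"
    unfolding es_def distinct_map
  proof (intro conjI inj_onI)
    fix k l assume kl: "k \<in> set [0..<i]" "l \<in> set [0..<i]" "step_edge v k = step_edge v l"
    \<comment> \<open>Equal labels give positions of equal parity, and equal vertex sets leave only
      \<open>k = l\<close> or \<open>k = Suc l\<close>.\<close>
    then have par: "even k = even l" using ab by (auto simp: step_edge_def split: if_splits)
    have "{walk v k, walk v (Suc k)} = {walk v l, walk v (Suc l)}"
      using kl by (simp add: step_edge_def)
    then have "walk v k = walk v l \<or> walk v k = walk v (Suc l)" by blast
    then have "k = l \<or> k = Suc l"
      using kl(1,2) j inj_onD[OF inj, of k l] inj_onD[OF inj, of k "Suc l"]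
      by (auto simp del: walk.simps)
    then show "k = l" using par by auto
  qed simp
  moreover have "set es = edges_within E (component v)"
  proof
    show "set es \<subseteq> edges_within E (component v)"
    proof
      fix e assume "e \<in> set es"
      then obtain k where k: "k < i" "e = step_edge v k" by (auto simp: es_def)
      then have "walk v (Suc k) \<noteq> walk v k" using j inj_onD[OF inj, of "Suc k" k] by auto
      then show "e \<in> edges_within E (component v)" using step_edge_within[OF v] k by simp
    qed
    have T: "(b, {u, t u}) \<in> set es" if u: "u \<in> component v" "t u \<noteq> u" for u
    proof -
      obtain k where k: "k < j" "u = walk v k" using u C by auto
      show ?thesis
      proof (cases "even k")
        case True
        then have "k \<noteq> i" using u k ij j by auto
        then show ?thesis using k j True by (auto simp: es_def step_edge_simps intro!: image_eqI[of _ _ k])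
      next
        case False
        then obtain l where "k = Suc l" "even l" by (cases k) auto
        then show ?thesis using k j step_edge_simps(3)[of l v] by (auto simp: es_def intro!: image_eqI[of _ _ l])
      qed
    qed
    have S: "(a, {u, s u}) \<in> set es" if u: "u \<in> component v" "s u \<noteq> u" for u
    proof -
      obtain k where k: "k < j" "u = walk v k" using u C by auto
      show ?thesis
      proof (cases "odd k")
        case True
        then have "k \<noteq> i" using u k ij j by auto
        then show ?thesis using k j True by (auto simp: es_def step_edge_simps intro!: image_eqI[of _ _ k])
      next
        case False
        moreover have "k \<noteq> 0" using u k fixed by (metis walk.simps(1))
        ultimately obtain l where "k = Suc l" "odd l" by (cases k) auto
        then show ?thesis using k j step_edge_simps(4)[of l v] by (auto simp: es_def intro!: image_eqI[of _ _ l])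
      qed
    qed
    show "edges_within E (component v) \<subseteq> set es"
      unfolding edges_within_comp[OF v] using S T by auto
  qed
  moreover have "length vs = length es + 1" by (simp add: vs_def es_def j)
  moreover have "\<forall>k < length es. snd (es ! k) = {vs ! k, vs ! (k + 1)}"
    using j by (auto simp: vs_def es_def step_edge_def simp del: upt_Suc walk.simps)
  ultimately show ?thesis
    unfolding is_path_def by (intro exI[of _ vs] exI[of _ es]) simp
qed

text \<open>Every step moves, so \<open>walk_repeat\<close> leaves only the return to
  \<open>v\<close> after an even number \<open>j\<close> of steps.\<close>

lemma cycle_if_no_fixed:
  assumes v: "v \<in> V" and no: "\<And>u. u \<in> component v \<Longrightarrow> s u \<noteq> u \<and> t u \<noteq> u"
  shows "is_cycle E (component v)"
proof -
  have move: "walk v (Suc k) \<noteq> walk v k" for k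
    using no[OF walk_in_comp[OF v]] by simp
  obtain i j where ij: "i < j" "walk v i = walk v j" and inj: "inj_on (walk v) {..<j}"
    and *: "Suc i = j \<or> i = 0 \<and> even j"
    using walk_repeat[OF v] .
  have "Suc i \<noteq> j" using move[of i] ij by auto
  with * ij have j: "0 < j" "even j" "walk v j = v" by auto
  \<comment> \<open>The successor on the cycle. As \<open>j\<close> is even, parity alternates at
    the wrap to \<open>0\<close> as well.\<close>
  define nxt where "nxt k = Suc k mod j" for k
  have nxt: "nxt k < j" "even (nxt k) \<longleftrightarrow> odd k" "walk v (nxt k) = walk v (Suc k)" if "k < j" for k
    using that j by (cases "Suc k = j"; force simp: nxt_def)+
  have prev: "\<exists>l<j. k = nxt l" if "k < j" for k
  proof (cases k)
    case 0
    then show ?thesis using j by (intro exI[of _ "j - 1"]) (auto simp: nxt_def)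
  next
    case (Suc l)
    then show ?thesis using that by (intro exI[of _ l]) (auto simp: nxt_def)
  qed
  have C: "component v = walk v ` {..<j}"
  proof
    show "component v \<subseteq> walk v ` {..<j}"
    proof (rule component_least)
      show "v \<in> walk v ` {..<j}" using j by (intro image_eqI[of _ _ 0]) simp_all
    next
      fix u assume "u \<in> walk v ` {..<j}"
      then obtain k where k: "k < j" "u = walk v k" by auto
      obtain l where l: "l < j" "k = nxt l" using prev k by blast
      have "walk v (Suc k) \<in> walk v ` {..<j}"
        using nxt[OF k(1)] by (metis imageI lessThan_iff)
      moreover have "(if even k then s u else t u) = walk v l"
        using nxt[OF l(1)] l k walk_back[of l v] by auto
      ultimately show "s u \<in> walk v ` {..<j} \<and> t u \<in> walk v ` {..<j}"
        using k l by (cases "even k") auto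
    qed
    show "walk v ` {..<j} \<subseteq> component v" using walk_in_comp[OF v] by auto
  qed
  define vs es where "vs = map (walk v) [0..<j]" and "es = map (step_edge v) [0..<j]"
  have "distinct vs"
    using inj by (simp add: vs_def distinct_map lessThan_atLeast0)
  moreover have "set vs = component v"
    using C by (simp add: vs_def lessThan_atLeast0)
  moreover have "distinct es"
    unfolding es_def distinct_map
  proof (intro conjI inj_onI)
    fix k l assume kl: "k \<in> set [0..<j]" "l \<in> set [0..<j]" "step_edge v k = step_edge v l"
    \<comment> \<open>For \<open>j = 2\<close> the two edges have the same vertex set; only the
      labels, hence the parities, tell them apart.\<close>
    then have par: "even k = even l" using ab by (auto simp: step_edge_def split: if_splits)
    have "{walk v k, walk v (Suc k)} = {walk v l, walk v (Suc l)}"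
      using kl by (simp add: step_edge_def)
    then have "walk v k = walk v l \<or> walk v k = walk v (nxt l)"
      using nxt(3)[of l] kl(2) by (auto simp del: walk.simps)
    then have "k = l \<or> k = nxt l"
      using kl(1,2) nxt(1)[of l] inj_onD[OF inj, of k l] inj_onD[OF inj, of k "nxt l"] by auto
    then show "k = l" using par nxt(2)[of l] kl(2) by auto
  qed simp
  moreover have "set es = edges_within E (component v)"
  proof
    show "set es \<subseteq> edges_within E (component v)"
      unfolding es_def using step_edge_within[OF v move] by auto
    \<comment> \<open>The two edges at a vertex are the step out of it and the step into it.\<close>
    have "(b, {u, t u}) \<in> set es \<and> (a, {u, s u}) \<in> set es" if u: "u \<in> component v" for u
    proof -
      obtain k where k: "k < j" "u = walk v k" using u C by auto
      obtain l where l: "l < j" "k = nxt l" using prev k by blast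
      have u': "u = walk v (Suc l)" using nxt(3)[OF l(1)] k l by simp
      have "step_edge v k \<in> set es" "step_edge v l \<in> set es"
        using k l by (auto simp: es_def)
      moreover have "even k \<longleftrightarrow> odd l" using nxt l by simp
      ultimately show ?thesis
        using step_edge_simps(1,2)[of k v] step_edge_simps(3,4)[of l v] k(2) u'
        by (cases "even k") (simp_all del: walk.simps)
    qed
    then show "edges_within E (component v) \<subseteq> set es"
      unfolding edges_within_comp[OF v] by auto
  qed
  moreover have "length vs = length es" by (simp add: vs_def es_def)
  moreover have "2 \<le> length es" using j by (simp add: es_def) presburger
  moreover have "\<forall>k < length es. snd (es ! k) = {vs ! k, vs ! ((k + 1) mod length vs)}"
    using nxt(1,3) by (auto simp: vs_def es_def step_edge_def nxt_def simp del: upt_Suc walk.simps)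
  ultimately show ?thesis
    unfolding is_cycle_def by (intro exI[of _ vs] exI[of _ es]) simp
qed

end

section \<open>Counting orbits component by component\<close>

lemma two_involutions_swap:
  assumes "two_involutions V s t a b"
  shows "two_involutions V t s b a"
  using assms unfolding two_involutions_def by auto

text \<open>A path has one vertex more than edges, a cycle has equally many.\<close>

lemma not_path_and_cycle: "is_cycle E C \<Longrightarrow> \<not> is_path E C"
proof
  assume "is_cycle E C" "is_path E C"
  then have "card C = card (edges_within E C)" "card C = card (edges_within E C) + 1"
    unfolding is_cycle_def is_path_def by (auto dest!: distinct_card)
  then show False by simp
qed

context two_involutions
begin

text \<open>A component with a fixed point of \<open>s\<close> or \<open>t\<close> is a path with
  one orbit; any other is a cycle with two.\<close>

lemma card_orbits_comp:
  assumes v: "v \<in> V"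
  shows "card (orbit (s \<circ> t) ` component v) =
    2 * of_bool (is_cycle E (component v)) + of_bool (is_path E (component v))"
proof (cases "\<exists>u\<in>component v. s u = u \<or> t u = u")
  case True
  then obtain u where u: "u \<in> component v" "s u = u \<or> t u = u" by blast
  then have uV: "u \<in> V" and C: "component u = component v" using component_closed[OF v] component_eq by auto
  \<comment> \<open>\<open>path_if_fixed\<close> treats fixed points of \<open>s\<close>; the
    exchanged instance, which has the same graph, treats those of \<open>t\<close>.\<close>
  interpret swap: two_involutions V t s b a
    by (rule two_involutions_swap) (rule two_involutions_axioms)
  have E: "swap.E = E" unfolding E_def swap.E_def by blast
  then have "swap.component u = component u" unfolding component_def swap.component_def by simp
  then have "is_path E (component v)"
    using path_if_fixed[OF uV] swap.path_if_fixed[OF uV] u E C by auto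
  then show ?thesis
    using not_path_and_cycle orbits_fixed_point[OF uV u(2)] C by auto
next
  case False
  then have "is_cycle E (component v)"
    by (intro cycle_if_no_fixed v) blast
  then show ?thesis
    using False orbits_no_fixed_point[OF v] not_path_and_cycle by auto
qed

lemma orbit_count_components:
  "orbit_count (s \<circ> t) V =
    2 * card {C \<in> components V E. is_cycle E C} + card {C \<in> components V E. is_path E C}"
proof -
  let ?K = "component ` V"
  have "orbit (s \<circ> t) ` V = (\<Union>C\<in>?K. orbit (s \<circ> t) ` C)"
    using component_closed(1) component_refl by blast
  moreover have "card (\<Union>C\<in>?K. orbit (s \<circ> t) ` C) = (\<Sum>C\<in>?K. card (orbit (s \<circ> t) ` C))"
  proof (rule card_UN_disjoint)
    show "finite ?K" using fin by simp
    show "\<forall>C\<in>?K. finite (orbit (s \<circ> t) ` C)"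
    proof
      fix C assume "C \<in> ?K"
      then have "C \<subseteq> V" using component_closed(1) by auto
      then show "finite (orbit (s \<circ> t) ` C)" using fin finite_subset by blast
    qed
    show "\<forall>C\<in>?K. \<forall>D\<in>?K. C \<noteq> D \<longrightarrow> orbit (s \<circ> t) ` C \<inter> orbit (s \<circ> t) ` D = {}"
    proof (intro ballI impI equals0I)
      fix C D X assume *: "C \<in> ?K" "D \<in> ?K" "C \<noteq> D"
        and "X \<in> orbit (s \<circ> t) ` C \<inter> orbit (s \<circ> t) ` D"
      then obtain x y where xy: "x \<in> C" "y \<in> D" "orbit (s \<circ> t) x = orbit (s \<circ> t) y" by auto
      obtain c d where cd: "C = component c" "D = component d" "d \<in> V" using * by auto
      \<comment> \<open>Orbits lie within components, so a common orbit puts \<open>x\<close> into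
        both.\<close>
      then have "x \<in> component d"
        using xy orbit_subset_comp[of d y] st_self[of x] by auto
      then have "C = D" using component_eq[of x c] component_eq[of x d] xy cd by simp
      with * show False by simp
    qed
  qed
  moreover have "(\<Sum>C\<in>?K. card (orbit (s \<circ> t) ` C)) =
      (\<Sum>C\<in>?K. 2 * of_bool (is_cycle E C) + of_bool (is_path E C))"
    by (rule sum.cong) (use card_orbits_comp in auto)
  moreover have "\<dots> = 2 * card {C \<in> ?K. is_cycle E C} + card {C \<in> ?K. is_path E C}"
    using fin by (simp add: sum.distrib flip: sum_distrib_left) (simp add: of_bool_def sum.If_cases Int_def)
  ultimately show ?thesis
    by (simp add: orbit_count_def components_eq)
qed

end

text \<open>The passage from graphs to orbit counts: upper and lower edges are the arcs of two block
  reversals.\<close>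

lemma meander_index_eq_ind:
  assumes "sum_list la = n" "sum_list mu = n"
  shows "meander_index n la mu = ind 0 la mu"
proof -
  have V: "{1..n} = {0<..0 + sum_list la}" "{1..n} = {0<..0 + sum_list mu}" using assms by auto
  interpret two_involutions "{1..n}" "flip 0 la" "flip 0 mu" Upper Lower
    using flip_permutes[of 0 la] flip_permutes[of 0 mu] V by unfold_locales simp_all
  have "E = meander_edges la mu"
    unfolding E_def meander_edges_def block_arcs_eq_arcs using V by simp
  then show ?thesis
    using orbit_count_components V by (simp add: meander_index_def ind_def)
qed

section \<open>Generating functions\<close>

text \<open>The offset \<open>k\<close> allows truncated lists to keep the total \<open>n\<close>, so that the recurrences below
  need no subtraction.\<close>

definition comps :: "nat \<Rightarrow> nat \<Rightarrow> nat list set" where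
  "comps k n = {la. set la \<subseteq> {2, 3} \<and> sum_list la + k = n}"

lemma finite_comps: "finite (comps k n)"
proof (rule finite_subset)
  have len: "length la \<le> sum_list la" if "set la \<subseteq> {2, 3}" for la :: "nat list"
    using that by (induction la) auto
  show "comps k n \<subseteq> {la. set la \<subseteq> {2, 3} \<and> length la \<le> n}"
  proof
    fix la assume "la \<in> comps k n"
    then show "la \<in> {la. set la \<subseteq> {2, 3} \<and> length la \<le> n}"
      using len[of la] by (simp add: comps_def)
  qed
  show "finite {la :: nat list. set la \<subseteq> {2, 3} \<and> length la \<le> n}"
    by (rule finite_lists_length_le) simp
qed

lemma comps_shift: "comps (k + i) n = (if n < k then {} else comps i (n - k))"
  by (auto simp: comps_def)

lemma sum_comps:
  fixes F :: "nat list \<Rightarrow> 'a :: comm_monoid_add"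
  shows "(\<Sum>la\<in>comps k n. F la) = (if k = n then F [] else 0) +
    (\<Sum>la\<in>comps (k + 2) n. F (2 # la)) + (\<Sum>la\<in>comps (k + 3) n. F (3 # la))"
proof -
  define N where "N = (if k = n then {[] :: nat list} else {})"
  have cases: "la \<in> N \<or> la \<in> (#) 2 ` comps (k + 2) n \<or> la \<in> (#) 3 ` comps (k + 3) n"
    if "la \<in> comps k n" for la
    using that by (cases la) (auto simp: comps_def N_def)
  have "comps k n = N \<union> (#) 2 ` comps (k + 2) n \<union> (#) 3 ` comps (k + 3) n"
  proof
    show "comps k n \<subseteq> N \<union> (#) 2 ` comps (k + 2) n \<union> (#) 3 ` comps (k + 3) n"
      using cases by blast
    show "N \<union> (#) 2 ` comps (k + 2) n \<union> (#) 3 ` comps (k + 3) n \<subseteq> comps k n"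
      by (auto simp: comps_def N_def)
  qed
  moreover have "finite N" "N \<inter> (#) 2 ` comps (k + 2) n = {}"
    "(N \<union> (#) 2 ` comps (k + 2) n) \<inter> (#) 3 ` comps (k + 3) n = {}"
    by (auto simp: N_def)
  ultimately have "sum F (comps k n) =
      sum F N + sum F ((#) 2 ` comps (k + 2) n) + sum F ((#) 3 ` comps (k + 3) n)"
    using finite_comps by (simp add: sum.union_disjoint)
  then show ?thesis
    by (simp add: sum.reindex N_def)
qed

text \<open>The coefficient of \<open>x^n\<close> as a power series in \<open>y\<close>: here
  \<open>fps_X\<close> is the inner variable. The offsets record how much has been split off on
  either side.\<close>

definition pair_sum :: "nat \<Rightarrow> nat \<Rightarrow> nat \<Rightarrow> (nat list \<Rightarrow> nat list \<Rightarrow> nat) \<Rightarrow> rat fps" where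
  "pair_sum k j n w = (\<Sum>la\<in>comps k n. \<Sum>mu\<in>comps j n. fps_X ^ w la mu)"

lemma pair_sum_cong:
  assumes "\<And>la mu. sum_list la + k = n \<Longrightarrow> sum_list mu + j = n \<Longrightarrow> w la mu = w' la mu"
  shows "pair_sum k j n w = pair_sum k j n w'"
  unfolding pair_sum_def using assms by (intro sum.cong refl) (simp add: comps_def)

lemma pair_sum_swap: "pair_sum k j n w = pair_sum j k n (\<lambda>la mu. w mu la)"
  unfolding pair_sum_def by (rule sum.swap)

text \<open>A total of \<open>i\<close> removed from both sides contributes \<open>X ^ i\<close>; a
  constant \<open>m\<close> in the weight contributes \<open>Y ^ m\<close>.\<close>

lemma pair_sum_shift:
  "pair_sum (i + k) (i + j) n (\<lambda>la mu. m + w la mu) =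
    (X ^ i * Y ^ m * Abs_fps (\<lambda>n. pair_sum k j n w)) $ n"
proof -
  have "X ^ i * Y ^ m * Abs_fps (\<lambda>n. pair_sum k j n w) =
      fps_const (fps_X ^ m) * (X ^ i * Abs_fps (\<lambda>n. pair_sum k j n w))"
    by (simp add: fps_const_power mult.left_commute mult.assoc)
  moreover have "pair_sum (i + k) (i + j) n w = (X ^ i * Abs_fps (\<lambda>n. pair_sum k j n w)) $ n"
    by (simp add: pair_sum_def comps_shift fps_X_power_mult_nth)
  moreover have "pair_sum (i + k) (i + j) n (\<lambda>la mu. m + w la mu) =
      fps_X ^ m * pair_sum (i + k) (i + j) n w"
    by (simp add: pair_sum_def power_add sum_distrib_left)
  ultimately show ?thesis by (simp only: fps_mult_left_const_nth)
qed

text \<open>The left list has the larger total, so it is nonempty in every pair.\<close>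

lemma pair_sum_rec_left:
  assumes "k < j"
  shows "pair_sum k j n w =
    pair_sum (k + 2) j n (\<lambda>la. w (2 # la)) + pair_sum (k + 3) j n (\<lambda>la. w (3 # la))"
proof -
  have "k = n \<Longrightarrow> comps j n = {}" using assms by (auto simp: comps_def)
  then show ?thesis
    unfolding pair_sum_def by (subst sum_comps) (auto split: if_splits)
qed

lemma pair_sum_rec_diag:
  "pair_sum k k n w = (if n = k then fps_X ^ w [] [] else 0) +
    pair_sum (k + 2) (k + 2) n (\<lambda>la mu. w (2 # la) (2 # mu)) +
    pair_sum (k + 2) (k + 3) n (\<lambda>la mu. w (2 # la) (3 # mu)) +
    pair_sum (k + 3) (k + 2) n (\<lambda>la mu. w (3 # la) (2 # mu)) +
    pair_sum (k + 3) (k + 3) n (\<lambda>la mu. w (3 # la) (3 # mu))"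
proof -
  note rec = sum_comps[of _ k n, where ?'a = "rat fps"]
  have "pair_sum k k n w = (if k = n then \<Sum>mu\<in>comps k n. fps_X ^ w [] mu else 0) +
      (\<Sum>la\<in>comps (k + 2) n. \<Sum>mu\<in>comps k n. fps_X ^ w (2 # la) mu) +
      (\<Sum>la\<in>comps (k + 3) n. \<Sum>mu\<in>comps k n. fps_X ^ w (3 # la) mu)"
    unfolding pair_sum_def by (rule rec)
  moreover have "comps (n + 2) n = {}" "comps (n + 3) n = {}" by (auto simp: comps_def)
  ultimately show ?thesis
    by (cases "k = n") (simp_all only: rec sum_comps[of _ n n] pair_sum_def sum.distrib sum.empty if_True if_False
      add_0 add_0_right simp_thms add.assoc eq_commute[of n k])
qed

text \<open>The offset is made positive so that rewriting stops at \<open>ind 0\<close>.\<close>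

lemmas ind_Suc = ind_translate[where p = "Suc p" for p]

section \<open>Recurrences for the two series\<close>

definition A_gf :: fps2 where
  "A_gf = Abs_fps (\<lambda>n. pair_sum 0 0 n (ind 0))"

text \<open>The offset \<open>1\<close> on the right makes room for the leading block, so
  \<open>X\<close> counts it too.\<close>

definition B_gf :: fps2 where
  "B_gf = Abs_fps (\<lambda>n. pair_sum 0 1 n (\<lambda>la mu. ind 0 la (1 # mu)))"

text \<open>Sort by first blocks. Equal ones cancel by \<open>ind_2_2\<close> and
  \<open>ind_3_3\<close>; a \<open>2\<close> against a \<open>3\<close> leaves a \<open>1\<close> by
  \<open>ind_2_3\<close>, and the mirrored case doubles this term.\<close>

lemma A_rec: "A_gf = 1 + (X ^ 2 * Y ^ 2 + X ^ 3 * Y ^ 3) * A_gf + 2 * X ^ 2 * B_gf"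
proof (rule fps_ext)
  fix n
  have "pair_sum 2 2 n (\<lambda>la mu. ind 0 (2 # la) (2 # mu)) =
      pair_sum 2 2 n (\<lambda>la mu. 2 + ind 0 la mu)"
    by (rule pair_sum_cong) (simp add: ind_2_2 ind_Suc)
  also have "\<dots> = (X ^ 2 * Y ^ 2 * A_gf) $ n"
    using pair_sum_shift[of 2 0 0 n 2 "ind 0"] by (simp add: A_gf_def)
  finally have 22: "pair_sum 2 2 n (\<lambda>la mu. ind 0 (2 # la) (2 # mu)) = (X ^ 2 * Y ^ 2 * A_gf) $ n" .
  have "pair_sum 3 3 n (\<lambda>la mu. ind 0 (3 # la) (3 # mu)) =
      pair_sum 3 3 n (\<lambda>la mu. 3 + ind 0 la mu)"
    by (rule pair_sum_cong) (simp add: ind_3_3 ind_Suc)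
  also have "\<dots> = (X ^ 3 * Y ^ 3 * A_gf) $ n"
    using pair_sum_shift[of 3 0 0 n 3 "ind 0"] by (simp add: A_gf_def)
  finally have 33: "pair_sum 3 3 n (\<lambda>la mu. ind 0 (3 # la) (3 # mu)) = (X ^ 3 * Y ^ 3 * A_gf) $ n" .
  have "pair_sum 2 3 n (\<lambda>la mu. ind 0 (2 # la) (3 # mu)) =
      pair_sum 2 3 n (\<lambda>la mu. ind 0 la (1 # mu))"
    by (rule pair_sum_cong) (simp add: ind_2_3 ind_Suc)
  also have "\<dots> = (X ^ 2 * B_gf) $ n"
    using pair_sum_shift[of 2 0 1 n 0] by (simp add: B_gf_def)
  finally have 23: "pair_sum 2 3 n (\<lambda>la mu. ind 0 (2 # la) (3 # mu)) = (X ^ 2 * B_gf) $ n" .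
  have "pair_sum 3 2 n (\<lambda>la mu. ind 0 (3 # la) (2 # mu)) =
      pair_sum 2 3 n (\<lambda>la mu. ind 0 (2 # la) (3 # mu))"
    by (subst pair_sum_swap, rule pair_sum_cong, rule ind_commute) simp
  then have 32: "pair_sum 3 2 n (\<lambda>la mu. ind 0 (3 # la) (2 # mu)) = (X ^ 2 * B_gf) $ n"
    using 23 by simp
  have "ind 0 [] [] = 0" by (simp add: ind_def orbit_count_def)
  moreover have "A_gf $ n = pair_sum 0 0 n (ind 0)" by (simp add: A_gf_def)
  ultimately have "A_gf $ n =
      (1 + X ^ 2 * Y ^ 2 * A_gf + X ^ 2 * B_gf + X ^ 2 * B_gf + X ^ 3 * Y ^ 3 * A_gf) $ n"
    by (subst (asm) pair_sum_rec_diag)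
      (simp only: add_0 22 23 32 33 power_0 fps_add_nth fps_one_nth)
  also have "1 + X ^ 2 * Y ^ 2 * A_gf + X ^ 2 * B_gf + X ^ 2 * B_gf + X ^ 3 * Y ^ 3 * A_gf =
      1 + (X ^ 2 * Y ^ 2 + X ^ 3 * Y ^ 3) * A_gf + 2 * X ^ 2 * B_gf"
    by (simp add: algebra_simps)
  finally show "A_gf $ n = (1 + (X ^ 2 * Y ^ 2 + X ^ 3 * Y ^ 3) * A_gf + 2 * X ^ 2 * B_gf) $ n" .
qed

text \<open>By \<open>ind_1_2\<close> a \<open>2\<close> against the leading \<open>1\<close> leaves
  a \<open>1\<close> on the other side, again of type \<open>B_gf\<close>. A \<open>3\<close> leaves
  \<open>1, 1\<close>, and one more block is read: \<open>ind_11_2\<close> balances the sides,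
  \<open>ind_11_3\<close> leaves one \<open>1\<close>.\<close>

lemma B_rec: "B_gf = X * B_gf + X ^ 3 * Y * A_gf + X ^ 3 * Y * B_gf"
proof (rule fps_ext)
  fix n
  have 1: "1 + 2 = (3 :: nat)" "1 + 3 = (4 :: nat)" by simp_all
  have "pair_sum 2 1 n (\<lambda>la mu. ind 0 (2 # la) (1 # mu)) =
      pair_sum 1 2 n (\<lambda>la mu. ind 0 la (1 # mu))"
    by (subst pair_sum_swap, rule pair_sum_cong, subst ind_commute) (simp_all add: ind_1_2 ind_Suc del: One_nat_def)
  also have "\<dots> = (X * B_gf) $ n"
    using pair_sum_shift[of 1 0 1 n 0] by (simp add: B_gf_def numeral_2_eq_2)
  finally have 2: "pair_sum 2 1 n (\<lambda>la mu. ind 0 (2 # la) (1 # mu)) = (X * B_gf) $ n" .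
  have "pair_sum 3 1 n (\<lambda>la mu. ind 0 (3 # la) (1 # mu)) =
      pair_sum 1 3 n (\<lambda>la mu. ind 0 la (1 # 1 # mu))"
    by (subst pair_sum_swap, rule pair_sum_cong, subst ind_commute) (simp_all add: ind_1_3 ind_Suc del: One_nat_def)
  \<comment> \<open>The total of the left list exceeds that of \<open>mu\<close> by two, so its
    first block can be read off.\<close>
  also have "\<dots> = pair_sum 3 3 n (\<lambda>la mu. ind 0 (2 # la) (1 # 1 # mu)) +
      pair_sum 4 3 n (\<lambda>la mu. ind 0 (3 # la) (1 # 1 # mu))"
    by (rule pair_sum_rec_left[of 1 3, unfolded 1]) simp
  also have "pair_sum 3 3 n (\<lambda>la mu. ind 0 (2 # la) (1 # 1 # mu)) = pair_sum 3 3 n (\<lambda>la mu. 1 + ind 0 la mu)"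
    by (subst pair_sum_swap, rule pair_sum_cong, subst ind_commute) (simp_all add: ind_11_2 ind_Suc del: One_nat_def)
  also have "\<dots> = (X ^ 3 * Y * A_gf) $ n"
    using pair_sum_shift[of 3 0 0 n 1 "ind 0"] by (simp add: A_gf_def)
  also have "pair_sum 4 3 n (\<lambda>la mu. ind 0 (3 # la) (1 # 1 # mu)) =
      pair_sum 3 4 n (\<lambda>la mu. 1 + ind 0 la (1 # mu))"
    by (subst pair_sum_swap, rule pair_sum_cong, subst ind_commute) (simp_all add: ind_11_3 ind_Suc del: One_nat_def)
  also have "\<dots> = (X ^ 3 * Y * B_gf) $ n"
    using pair_sum_shift[of 3 0 1 n 1] by (simp add: B_gf_def)
  finally have 3: "pair_sum 3 1 n (\<lambda>la mu. ind 0 (3 # la) (1 # mu)) =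
      (X ^ 3 * Y * A_gf) $ n + (X ^ 3 * Y * B_gf) $ n" .
  have "B_gf $ n = pair_sum 2 1 n (\<lambda>la mu. ind 0 (2 # la) (1 # mu)) +
      pair_sum 3 1 n (\<lambda>la mu. ind 0 (3 # la) (1 # mu))"
    unfolding B_gf_def fps_nth_Abs_fps
    by (subst pair_sum_rec_left) (simp_all only: add_0 zero_less_one)
  then show "B_gf $ n = (X * B_gf + X ^ 3 * Y * A_gf + X ^ 3 * Y * B_gf) $ n"
    using 2 3 by simp
qed

section \<open>Counts of meanders and scaled parts\<close>

lemma composition_of_subset:
  "0 \<notin> J \<Longrightarrow> composition_of n la \<and> set la \<subseteq> J \<longleftrightarrow> set la \<subseteq> J \<and> sum_list la = n"
  unfolding composition_of_def by (auto intro: gr0I)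

lemma meander_count_eq:
  assumes "0 \<notin> J"
  shows "meander_count J n k =
    card {(la, mu). set la \<subseteq> J \<and> sum_list la = n \<and> set mu \<subseteq> J \<and> sum_list mu = n \<and> ind 0 la mu = k}"
proof -
  have "composition_of n la \<and> composition_of n mu \<and> set la \<subseteq> J \<and> set mu \<subseteq> J \<and>
      meander_index n la mu = k \<longleftrightarrow>
    set la \<subseteq> J \<and> sum_list la = n \<and> set mu \<subseteq> J \<and> sum_list mu = n \<and> ind 0 la mu = k" for la mu
    using composition_of_subset[OF assms, of n la] composition_of_subset[OF assms, of n mu]
      meander_index_eq_ind[of la n mu] by metis
  then show ?thesis
    by (simp add: meander_count_def)
qed

lemma meander_gf_eq: "meander_gf {2, 3} = A_gf"
proof (intro fps_ext)
  fix n k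
  let ?P = "comps 0 n \<times> comps 0 n"
  have "{(la, mu). set la \<subseteq> {2, 3} \<and> sum_list la = n \<and> set mu \<subseteq> {2, 3} \<and> sum_list mu = n \<and>
      ind 0 la mu = k} = {p \<in> ?P. ind 0 (fst p) (snd p) = k}"
    by (auto simp: comps_def)
  then have "meander_count {2, 3} n k = card {p \<in> ?P. ind 0 (fst p) (snd p) = k}"
    by (simp add: meander_count_eq)
  also have "rat_of_nat \<dots> = (\<Sum>p\<in>?P. (fps_X ^ ind 0 (fst p) (snd p)) $ k)"
    using finite_comps by (simp add: sum.If_cases Int_def eq_commute)
  also have "\<dots> = A_gf $ n $ k"
    by (simp add: A_gf_def pair_sum_def fps_sum_nth sum.cartesian_product case_prod_beta)
  finally show "meander_gf {2, 3} $ n $ k = A_gf $ n $ k"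
    by (simp add: meander_gf_def)
qed

text \<open>Multiplying all parts by \<open>c\<close> is a bijection from lists over
  \<open>{2, 3}\<close> to lists over \<open>{2 * c, 3 * c}\<close>; by \<open>ind_scale\<close> it
  multiplies the index as well as the total by \<open>c\<close>.\<close>

lemma meander_count_scale:
  assumes c: "0 < c"
  shows "meander_count {2 * c, 3 * c} n k =
    (if c dvd n \<and> c dvd k then meander_count {2, 3} (n div c) (k div c) else 0)"
proof -
  let ?f = "map_prod (map ((*) c)) (map ((*) c))"
  let ?S = "{(la, mu). set la \<subseteq> {2, 3} \<and> c * sum_list la = n \<and> set mu \<subseteq> {2, 3} \<and>
      c * sum_list mu = n \<and> c * ind 0 la mu = k}"
  have scaled: "set la \<subseteq> {2 * c, 3 * c} \<longleftrightarrow> (\<exists>la'. la = map ((*) c) la' \<and> set la' \<subseteq> {2, 3})" for la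
  proof
    assume "set la \<subseteq> {2 * c, 3 * c}"
    then have "la = map ((*) c) (map (\<lambda>a. a div c) la) \<and> set (map (\<lambda>a. a div c) la) \<subseteq> {2, 3}"
      using c by (induction la) auto
    then show "\<exists>la'. la = map ((*) c) la' \<and> set la' \<subseteq> {2, 3}" by blast
  next
    assume "\<exists>la'. la = map ((*) c) la' \<and> set la' \<subseteq> {2, 3}"
    then obtain la' where "set la = (*) c ` set la'" "set la' \<subseteq> {2, 3}" by auto
    then have "set la \<subseteq> (*) c ` {2, 3}" by blast
    then show "set la \<subseteq> {2 * c, 3 * c}" by (simp add: mult.commute)
  qed
  have "{(la, mu). set la \<subseteq> {2 * c, 3 * c} \<and> sum_list la = n \<and> set mu \<subseteq> {2 * c, 3 * c} \<and>
      sum_list mu = n \<and> ind 0 la mu = k} = ?f ` ?S"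
    (is "?L = _")
  proof (intro equalityI subsetI)
    fix p assume "p \<in> ?L"
    then obtain la mu where p: "p = (la, mu)" and la: "set la \<subseteq> {2 * c, 3 * c}" "sum_list la = n"
      and mu: "set mu \<subseteq> {2 * c, 3 * c}" "sum_list mu = n" and k: "ind 0 la mu = k"
      by (cases p) simp
    obtain la' where la': "la = map ((*) c) la'" "set la' \<subseteq> {2, 3}"
      using la(1) unfolding scaled by (elim exE conjE)
    obtain mu' where mu': "mu = map ((*) c) mu'" "set mu' \<subseteq> {2, 3}"
      using mu(1) unfolding scaled by (elim exE conjE)
    have n: "c * sum_list la' = n" "c * sum_list mu' = n"
      using la(2) mu(2) by (simp_all add: la' mu' sum_list_const_mult)
    then have "sum_list la' = sum_list mu'" using c by (metis mult_cancel1 less_numeral_extra(3))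
    then have "c * ind 0 la' mu' = k" using ind_scale[OF c] k la' mu' by simp
    then have "(la', mu') \<in> ?S" using la' mu' n by simp
    then show "p \<in> ?f ` ?S" using la' mu' p by (intro image_eqI[of _ _ "(la', mu')"]) simp_all
  next
    fix p assume "p \<in> ?f ` ?S"
    then obtain la mu where p: "p = (map ((*) c) la, map ((*) c) mu)"
      and la: "set la \<subseteq> {2, 3}" "c * sum_list la = n"
      and mu: "set mu \<subseteq> {2, 3}" "c * sum_list mu = n" and k: "c * ind 0 la mu = k"
      by (elim imageE) (simp split: prod.splits)
    have "c * sum_list la = c * sum_list mu" using la(2) mu(2) by simp
    then have "sum_list la = sum_list mu" using c by simp
    then have "ind 0 (map ((*) c) la) (map ((*) c) mu) = k"
      using ind_scale[OF c] k by simp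
    moreover have "set (map ((*) c) la) \<subseteq> {2 * c, 3 * c}" "set (map ((*) c) mu) \<subseteq> {2 * c, 3 * c}"
      unfolding scaled using la(1) mu(1) by blast+
    ultimately show "p \<in> ?L" using la(2) mu(2) p by (simp add: sum_list_const_mult)
  qed
  moreover have "inj ?f"
    using c by (intro prod.inj_map) (simp_all add: inj_on_def)
  ultimately have "meander_count {2 * c, 3 * c} n k = card ?S"
    using c by (simp add: meander_count_eq card_image inj_on_subset[OF _ subset_UNIV])
  moreover have "?S = (if c dvd n \<and> c dvd k then
      {(la, mu). set la \<subseteq> {2, 3} \<and> sum_list la = n div c \<and> set mu \<subseteq> {2, 3} \<and>
        sum_list mu = n div c \<and> ind 0 la mu = k div c} else {})"
    using c by auto
  ultimately show ?thesis by (simp add: meander_count_eq)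
qed

lemma fps_compose_X_power_nth:
  fixes F :: "'a :: comm_ring_1 fps"
  assumes "0 < c"
  shows "(F oo fps_X ^ c) $ n = (if c dvd n then F $ (n div c) else 0)"
proof -
  have "(F oo fps_X ^ c) $ n = (\<Sum>i = 0..n. if n = c * i then F $ i else 0)"
    by (auto simp: fps_compose_nth simp flip: power_mult intro!: sum.cong)
  also have "\<dots> = (\<Sum>i \<in> {i \<in> {0..n}. n = c * i}. F $ i)"
    by (rule sum.inter_filter[symmetric]) simp
  also have "{i \<in> {0..n}. n = c * i} = (if c dvd n then {n div c} else {})"
    using assms by auto
  finally show ?thesis by auto
qed

theorem theorem4p1:
  shows "meander_gf {2, 3} =
      (1 - X - X ^ 3 * Y) /
      ((1 - X ^ 2 * Y ^ 2 - X ^ 3 * Y ^ 3) * (1 - X - X ^ 3 * Y) - 2 * X ^ 5 * Y) \<and>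
    (\<forall>c::nat. c \<ge> 1 \<longrightarrow> meander_gf {2 * c, 3 * c} = subst_powers c (meander_gf {2, 3}))"
proof (intro conjI allI impI)
  define N :: fps2 where "N = 1 - X - X ^ 3 * Y"
  define D where "D = (1 - X ^ 2 * Y ^ 2 - X ^ 3 * Y ^ 3) * N - 2 * X ^ 5 * Y"
  \<comment> \<open>\<open>B_rec\<close> is solved for \<open>B_gf\<close> only up to the factor
    \<open>N\<close>, which avoids a division.\<close>
  have B: "N * B_gf = X ^ 3 * Y * A_gf"
    unfolding N_def using B_rec by (simp add: algebra_simps)
  \<comment> \<open>Multiplied by \<open>N\<close>, the recurrence contains \<open>B_gf\<close> only
    as \<open>N * B_gf\<close>; replacing it yields the term \<open>2 * X ^ 5 * Y\<close> of
    \<open>D\<close>.\<close>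
  have "N * A_gf = N + (X ^ 2 * Y ^ 2 + X ^ 3 * Y ^ 3) * N * A_gf + 2 * X ^ 2 * (N * B_gf)"
    by (subst A_rec) (simp add: algebra_simps)
  then have AD: "A_gf * D = N"
    unfolding B D_def by (simp add: algebra_simps power_add[symmetric] eval_nat_numeral)
  have D0: "D $ 0 = 1"
    by (simp add: D_def N_def fps_mult_nth_0)
  have "subdegree D = 0" using D0 by (simp add: subdegree_eq_0_iff)
  \<comment> \<open>The coefficients are power series in \<open>y\<close> and form no field; the
    constant term \<open>1\<close> is what makes \<open>D\<close> invertible.\<close>
  have "inverse D = fps_right_inverse D 1"
    unfolding fps_inverse_def[of D] D0 by simp
  then have "D * inverse D = 1"
    using fps_right_inverse[of D 1] D0 by simp
  then show "meander_gf {2, 3} =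
      (1 - X - X ^ 3 * Y) /
      ((1 - X ^ 2 * Y ^ 2 - X ^ 3 * Y ^ 3) * (1 - X - X ^ 3 * Y) - 2 * X ^ 5 * Y)"
    unfolding meander_gf_eq N_def[symmetric] D_def[symmetric] fps_divide_unit'[OF \<open>subdegree D = 0\<close>]
    using AD by (metis mult.assoc mult.right_neutral)
next
  fix c :: nat
  assume "1 \<le> c"
  then have "0 < c" by simp
  \<comment> \<open>Coefficients are compared: both substitutions leave only exponents divisible by
    \<open>c\<close>, as does \<open>meander_count_scale\<close>.\<close>
  then show "meander_gf {2 * c, 3 * c} = subst_powers c (meander_gf {2, 3})"
    by (intro fps_ext)
      (simp add: meander_gf_def subst_powers_def fps_compose_X_power_nth meander_count_scale)
qed

end
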